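(* $P\Sigma_1 \vdash \mathsf{BME}_*$; that is, every instance of the principle $\mathsf{BME}_*$ is provable in the theory $P\Sigma_1$.
   Context: All theories are first-order arithmetic theories. $P^-$ is Peano arithmetic without induction, $\mathrm{EA}=P^-+$ totality of $x\mapsto 2^x$, and $I\Sigma_1$ is $P^-$ plus induction for $\Sigma_1$-formulas (note $I\Sigma_1\supseteq\mathrm{EA}$). Finite sequences are coded by numbers; $\mathrm{lth}(s)$ is the length of the sequence coded by $s$ and $(s)_i$ its $i$-th entry. Iteration principle. For a formula $\phi(x,y)$ (possibly with parameters), $\mathsf{PFUN}(\phi)$ is the statement that for every $x$ there is at most one $y$ with $\phi(x,y)$. $\mathsf{Approx}_\phi(s)$ is the statement that $s$ codes a finite sequence such that for all $i<\mathrm{lth}(s)-1$ and all $x,y$: if $x\le (s)_i$ and $\phi(x,y)$ then $y\le (s)_{i+1}$. $P\phi$ is the sentence $\mathsf{PFUN}(\phi)\to\forall z\,\exists s\,(\mathsf{Approx}_\phi(s)\wedge \mathrm{lth}(s)=z)$. The theory $P\Sigma_1$ is $I\Sigma_1$ together with all $P\phi$ for $\phi\in\Sigma_1$. Monotone enumerations (working over $\mathrm{EA}$, with a fixed coding of finite sequences of naturals and of finite sets of such sequences). Let $E$ be a function defined by a quantifier-free formula, with $E[s]$ regarded as (the code of) a finite set of finite sequences of natural numbers, such that $E[s]\subseteq E[s+1]$ for all $s$; $s$ is called the stage, and $\tau$ is enumerated at stage $s$ if $\tau\in E[s]\setminus E[s-1]$. The tree enumerated by $E$ is $\{\tau : \exists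 s\,\exists\sigma\in E[s]\ (\tau\preceq\sigma)\}$ ($\preceq$ = initial segment). $E$ is a monotone enumeration if: (1) the empty sequence $\langle\rangle$ is enumerated at the first stage; (2) at each stage only finitely many sequences are enumerated; (3) whenever $\tau$ is enumerated at stage $s$ and $\tau_0$ is the longest initial segment of $\tau$ enumerated at a stage prior to $s$, then (a) no extension of $\tau_0$ was enumerated by $E$ before stage $s$, and (b) all sequences enumerated at stage $s$ are extensions of $\tau_0$. For $\tau$ enumerated at stage $s$, its stage-by-stage sequence is the sequence of initial segments obtained by repeatedly passing from a sequence enumerated at some stage to its longest initial segment enumerated at an earlier stage, starting from $\tau$ and ending at $\langle\rangle$. $E$ is bounded by $b$ if for every $\tau$ in $E$ the length of its stage-by-stage sequence is at most $b$. $\mathsf{BME}_*$ is the statement: for every monotone enumeration $E$ and every $b$, if $E$ is bounded by $b$ then the tree enumerated by $E$ is finite. *)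

theory Defs
  imports Main
begin

section \<open>First-order logic in the language of arithmetic\<close>

text \<open>Formulas over the signature 0, 1, +, *, < with equality, using de Bruijn indices:
  \<^term>\<open>Var\<close> of index 0 refers to the innermost quantifier.\<close>

datatype tm = Var nat | Zero | One | Add tm tm | Mul tm tm

datatype fm = Bot | Eq tm tm | Less tm tm | Imp fm fm | All fm

definition Neg :: "fm \<Rightarrow> fm" where "Neg p = Imp p Bot"
definition Ex :: "fm \<Rightarrow> fm" where "Ex p = Neg (All (Neg p))"
definition Con :: "fm \<Rightarrow> fm \<Rightarrow> fm" where "Con p q = Neg (Imp p (Neg q))"
definition Dis :: "fm \<Rightarrow> fm \<Rightarrow> fm" where "Dis p q = Imp (Neg p) q"

primrec subst_tm :: "(nat \<Rightarrow> tm) \<Rightarrow> tm \<Rightarrow> tm" where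
  "subst_tm f (Var k) = f k"
| "subst_tm f Zero = Zero"
| "subst_tm f One = One"
| "subst_tm f (Add t u) = Add (subst_tm f t) (subst_tm f u)"
| "subst_tm f (Mul t u) = Mul (subst_tm f t) (subst_tm f u)"

definition lift_tm :: "tm \<Rightarrow> tm" where
  "lift_tm = subst_tm (\<lambda>k. Var (Suc k))"

primrec subst :: "(nat \<Rightarrow> tm) \<Rightarrow> fm \<Rightarrow> fm" where
  "subst f Bot = Bot"
| "subst f (Eq t u) = Eq (subst_tm f t) (subst_tm f u)"
| "subst f (Less t u) = Less (subst_tm f t) (subst_tm f u)"
| "subst f (Imp p q) = Imp (subst f p) (subst f q)"
| "subst f (All p) = All (subst (case_nat (Var 0) (\<lambda>k. lift_tm (f k))) p)"

definition lift :: "fm \<Rightarrow> fm" where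
  "lift = subst (\<lambda>k. Var (Suc k))"

definition inst :: "fm \<Rightarrow> tm \<Rightarrow> fm" where
  "inst p t = subst (case_nat t Var) p"

text \<open>A Hilbert calculus for classical logic with equality. The theory \<open>T\<close> is meant to consist of
  sentences, so that generalization is unrestricted.\<close>

inductive proves :: "fm set \<Rightarrow> fm \<Rightarrow> bool" (infix "\<turnstile>" 50) for T :: "fm set" where
  Ax: "p \<in> T \<Longrightarrow> T \<turnstile> p"
| K: "T \<turnstile> Imp p (Imp q p)"
| S: "T \<turnstile> Imp (Imp p (Imp q r)) (Imp (Imp p q) (Imp p r))"
| DN: "T \<turnstile> Imp (Neg (Neg p)) p"
| Inst: "T \<turnstile> Imp (All p) (inst p t)"
| Dist: "T \<turnstile> Imp (All (Imp (lift p) q)) (Imp p (All q))"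
| Refl: "T \<turnstile> Eq t t"
| Leibniz: "T \<turnstile> Imp (Eq t u) (Imp (inst p t) (inst p u))"
| MP: "T \<turnstile> Imp p q \<Longrightarrow> T \<turnstile> p \<Longrightarrow> T \<turnstile> q"
| Gen: "T \<turnstile> p \<Longrightarrow> T \<turnstile> All p"

primrec bound_tm :: "tm \<Rightarrow> nat" where
  "bound_tm (Var k) = Suc k"
| "bound_tm Zero = 0"
| "bound_tm One = 0"
| "bound_tm (Add t u) = max (bound_tm t) (bound_tm u)"
| "bound_tm (Mul t u) = max (bound_tm t) (bound_tm u)"

text \<open>All free variables of a formula have index below its \<open>bound\<close>.\<close>

primrec bound :: "fm \<Rightarrow> nat" where
  "bound Bot = 0"
| "bound (Eq t u) = max (bound_tm t) (bound_tm u)"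
| "bound (Less t u) = max (bound_tm t) (bound_tm u)"
| "bound (Imp p q) = max (bound p) (bound q)"
| "bound (All p) = bound p - 1"

definition univ_closure :: "fm \<Rightarrow> fm" where
  "univ_closure p = (All ^^ bound p) p"

text \<open>Lifting the bounding term keeps the quantified variable out of it. The bounded
  existential quantifier is the dual, and hence bounded again.\<close>

inductive Delta0 :: "fm \<Rightarrow> bool" where
  "Delta0 Bot"
| "Delta0 (Eq t u)"
| "Delta0 (Less t u)"
| "Delta0 p \<Longrightarrow> Delta0 q \<Longrightarrow> Delta0 (Imp p q)"
| "Delta0 p \<Longrightarrow> Delta0 (All (Imp (Less (Var 0) (lift_tm t)) p))"

inductive Sigma1 :: "fm \<Rightarrow> bool" where
  "Delta0 p \<Longrightarrow> Sigma1 p"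
| "Sigma1 p \<Longrightarrow> Sigma1 (Ex p)"


section \<open>Named binders\<close>

text \<open>To write concrete formulas with named bound variables, terms and formulas are taken as
  functions of the number \<open>d\<close> of quantifiers in whose scope they occur. A variable bound by the
  quantifier at depth \<open>k\<close> is index \<open>d - Suc k\<close> when it occurs at depth \<open>d\<close>.\<close>

type_synonym dtm = "nat \<Rightarrow> tm"
type_synonym dfm = "nat \<Rightarrow> fm"

definition dZero :: dtm ("\<^bold>0") where "\<^bold>0 = (\<lambda>d. Zero)"
definition dOne :: dtm ("\<^bold>1") where "\<^bold>1 = (\<lambda>d. One)"
definition dAdd :: "dtm \<Rightarrow> dtm \<Rightarrow> dtm" (infixl "\<^bold>+" 65)
  where "x \<^bold>+ y = (\<lambda>d. Add (x d) (y d))"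
definition dMul :: "dtm \<Rightarrow> dtm \<Rightarrow> dtm" (infixl "\<^bold>*" 70)
  where "x \<^bold>* y = (\<lambda>d. Mul (x d) (y d))"

definition dEq :: "dtm \<Rightarrow> dtm \<Rightarrow> dfm" (infix "\<^bold>=" 50)
  where "(x \<^bold>= y) = (\<lambda>d. Eq (x d) (y d))"
definition dLess :: "dtm \<Rightarrow> dtm \<Rightarrow> dfm" (infix "\<^bold><" 50)
  where "(x \<^bold>< y) = (\<lambda>d. Less (x d) (y d))"
definition dNot :: "dfm \<Rightarrow> dfm" ("\<^bold>\<not> _" [40] 40)
  where "(\<^bold>\<not> p) = (\<lambda>d. Neg (p d))"
definition dAnd :: "dfm \<Rightarrow> dfm \<Rightarrow> dfm" (infixr "\<^bold>\<and>" 35)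
  where "(p \<^bold>\<and> q) = (\<lambda>d. Con (p d) (q d))"
definition dOr :: "dfm \<Rightarrow> dfm \<Rightarrow> dfm" (infixr "\<^bold>\<or>" 30)
  where "(p \<^bold>\<or> q) = (\<lambda>d. Dis (p d) (q d))"
definition dImp :: "dfm \<Rightarrow> dfm \<Rightarrow> dfm" (infixr "\<^bold>\<longrightarrow>" 25)
  where "(p \<^bold>\<longrightarrow> q) = (\<lambda>d. Imp (p d) (q d))"
definition dIff :: "dfm \<Rightarrow> dfm \<Rightarrow> dfm" (infixr "\<^bold>\<longleftrightarrow>" 25)
  where "(p \<^bold>\<longleftrightarrow> q) = ((p \<^bold>\<longrightarrow> q) \<^bold>\<and> (q \<^bold>\<longrightarrow> p))"
definition dAll :: "(dtm \<Rightarrow> dfm) \<Rightarrow> dfm" (binder "\<^bold>\<forall>" 10)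
  where "dAll P = (\<lambda>d. All (P (\<lambda>d'. Var (d' - Suc d)) (Suc d)))"
definition dEx :: "(dtm \<Rightarrow> dfm) \<Rightarrow> dfm" (binder "\<^bold>\<exists>" 10)
  where "dEx P = (\<lambda>d. Ex (P (\<lambda>d'. Var (d' - Suc d)) (Suc d)))"
definition dLe :: "dtm \<Rightarrow> dtm \<Rightarrow> dfm" (infix "\<^bold>\<le>" 50)
  where "(x \<^bold>\<le> y) = (x \<^bold>< y \<^bold>\<or> x \<^bold>= y)"

lemma "(\<^bold>\<forall>x. \<^bold>\<exists>y. x \<^bold>< y \<^bold>\<and> (\<^bold>\<forall>z. x \<^bold>= z)) 0
    = All (Ex (Con (Less (Var 1) (Var 0)) (All (Eq (Var 2) (Var 0)))))"
  by (simp add: dAll_def dEx_def dLess_def dAnd_def dEq_def)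

text \<open>\<open>app1 p x\<close> is \<open>p(x)\<close> and \<open>app2 p x y\<close> is \<open>p(x,y)\<close>: the first argument replaces variable 0 of \<open>p\<close>,
  the second one variable 1, and the remaining variables of \<open>p\<close> are parameters, which stay free
  and therefore have to be raised by the current depth.\<close>

definition app1 :: "fm \<Rightarrow> dtm \<Rightarrow> dfm" where
  "app1 p x = (\<lambda>d. subst (case_nat (x d) (\<lambda>k. Var (k + d))) p)"

definition app2 :: "fm \<Rightarrow> dtm \<Rightarrow> dtm \<Rightarrow> dfm" where
  "app2 p x y = (\<lambda>d. subst (case_nat (x d) (case_nat (y d) (\<lambda>k. Var (k + d)))) p)"

definition sentence :: "dfm \<Rightarrow> fm" where
  "sentence p = univ_closure (p 0)"


section \<open>Coding of finite sequences and of finite sets of sequences\<close>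

text \<open>\<open>(x + y)\<^sup>2 + x\<close> is an injective pairing. The number \<open>\<langle>n, \<langle>a, b\<rangle>\<rangle>\<close> codes the sequence of length
  \<open>n\<close> whose \<open>i\<close>-th entry is Goedel's beta function, the remainder of \<open>a\<close> modulo \<open>1 + (i + 1) * b\<close>.
  A sequence has many codes, so sequences are compared entrywise, never by their codes.\<close>

definition pair :: "dtm \<Rightarrow> dtm \<Rightarrow> dtm" where
  "pair x y = (x \<^bold>+ y) \<^bold>* (x \<^bold>+ y) \<^bold>+ x"

definition Lth :: "dtm \<Rightarrow> dtm \<Rightarrow> dfm" where
  "Lth s n = (\<^bold>\<exists>a. \<^bold>\<exists>b. s \<^bold>= pair n (pair a b))"

definition Seq :: "dtm \<Rightarrow> dfm" where
  "Seq s = (\<^bold>\<exists>n. Lth s n)"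

text \<open>\<open>Entry s i v\<close>: \<open>i < lth(s)\<close> and \<open>(s)\<^sub>i = v\<close>.\<close>

definition Entry :: "dtm \<Rightarrow> dtm \<Rightarrow> dtm \<Rightarrow> dfm" where
  "Entry s i v = (\<^bold>\<exists>n. \<^bold>\<exists>a. \<^bold>\<exists>b. s \<^bold>= pair n (pair a b) \<^bold>\<and> i \<^bold>< n \<^bold>\<and>
     v \<^bold>< \<^bold>1 \<^bold>+ (i \<^bold>+ \<^bold>1) \<^bold>* b \<^bold>\<and> (\<^bold>\<exists>q. a \<^bold>= q \<^bold>* (\<^bold>1 \<^bold>+ (i \<^bold>+ \<^bold>1) \<^bold>* b) \<^bold>+ v))"

definition Initseg :: "dtm \<Rightarrow> dtm \<Rightarrow> dfm" where
  "Initseg s t = ((\<^bold>\<exists>m. \<^bold>\<exists>n. Lth s m \<^bold>\<and> Lth t n \<^bold>\<and> m \<^bold>\<le> n) \<^bold>\<and>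
     (\<^bold>\<forall>i. \<^bold>\<forall>v. Entry s i v \<^bold>\<longrightarrow> Entry t i v))"

definition SeqEq :: "dtm \<Rightarrow> dtm \<Rightarrow> dfm" where
  "SeqEq s t = (Initseg s t \<^bold>\<and> Initseg t s)"

text \<open>A finite set of sequences is coded by a sequence that lists (codes of) its members.\<close>

definition FinSet :: "dtm \<Rightarrow> dfm" where
  "FinSet c = (Seq c \<^bold>\<and> (\<^bold>\<forall>i. \<^bold>\<forall>v. Entry c i v \<^bold>\<longrightarrow> Seq v))"

definition Mem :: "dtm \<Rightarrow> dtm \<Rightarrow> dfm" where
  "Mem t c = (\<^bold>\<exists>i. \<^bold>\<exists>v. Entry c i v \<^bold>\<and> SeqEq v t)"

text \<open>A class of sequences is finite if it is the class of members of some code.\<close>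

definition IsFinite :: "(dtm \<Rightarrow> dfm) \<Rightarrow> dfm" where
  "IsFinite P = (\<^bold>\<exists>c. FinSet c \<^bold>\<and> (\<^bold>\<forall>t. P t \<^bold>\<longleftrightarrow> Mem t c))"


section \<open>The theories\<close>

definition Pminus :: "fm set" where
  "Pminus = sentence `
    {\<^bold>\<forall>x. \<^bold>\<forall>y. \<^bold>\<forall>z. (x \<^bold>+ y) \<^bold>+ z \<^bold>= x \<^bold>+ (y \<^bold>+ z),
     \<^bold>\<forall>x. \<^bold>\<forall>y. x \<^bold>+ y \<^bold>= y \<^bold>+ x,
     \<^bold>\<forall>x. \<^bold>\<forall>y. \<^bold>\<forall>z. (x \<^bold>* y) \<^bold>* z \<^bold>= x \<^bold>* (y \<^bold>* z),
     \<^bold>\<forall>x. \<^bold>\<forall>y. x \<^bold>* y \<^bold>= y \<^bold>* x,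
     \<^bold>\<forall>x. \<^bold>\<forall>y. \<^bold>\<forall>z. x \<^bold>* (y \<^bold>+ z) \<^bold>= x \<^bold>* y \<^bold>+ x \<^bold>* z,
     \<^bold>\<forall>x. x \<^bold>+ \<^bold>0 \<^bold>= x,
     \<^bold>\<forall>x. x \<^bold>* \<^bold>0 \<^bold>= \<^bold>0,
     \<^bold>\<forall>x. x \<^bold>* \<^bold>1 \<^bold>= x,
     \<^bold>\<forall>x. \<^bold>\<forall>y. \<^bold>\<forall>z. x \<^bold>< y \<^bold>\<and> y \<^bold>< z \<^bold>\<longrightarrow> x \<^bold>< z,
     \<^bold>\<forall>x. \<^bold>\<not> x \<^bold>< x,
     \<^bold>\<forall>x. \<^bold>\<forall>y. x \<^bold>< y \<^bold>\<or> x \<^bold>= y \<^bold>\<or> y \<^bold>< x,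
     \<^bold>\<forall>x. \<^bold>\<forall>y. \<^bold>\<forall>z. x \<^bold>< y \<^bold>\<longrightarrow> x \<^bold>+ z \<^bold>< y \<^bold>+ z,
     \<^bold>\<forall>x. \<^bold>\<forall>y. \<^bold>\<forall>z. \<^bold>0 \<^bold>< z \<^bold>\<and> x \<^bold>< y \<^bold>\<longrightarrow> x \<^bold>* z \<^bold>< y \<^bold>* z,
     \<^bold>\<forall>x. \<^bold>\<forall>y. x \<^bold>< y \<^bold>\<longrightarrow> (\<^bold>\<exists>z. x \<^bold>+ z \<^bold>= y),
     \<^bold>0 \<^bold>< \<^bold>1,
     \<^bold>\<forall>x. \<^bold>0 \<^bold>< x \<^bold>\<longrightarrow> \<^bold>1 \<^bold>\<le> x,
     \<^bold>\<forall>x. \<^bold>0 \<^bold>\<le> x}"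

definition Induction :: "fm \<Rightarrow> fm" where
  "Induction p = sentence
     (app1 p \<^bold>0 \<^bold>\<and> (\<^bold>\<forall>x. app1 p x \<^bold>\<longrightarrow> app1 p (x \<^bold>+ \<^bold>1)) \<^bold>\<longrightarrow> (\<^bold>\<forall>x. app1 p x))"

definition ISigma1 :: "fm set" where
  "ISigma1 = Pminus \<union> {Induction p | p. Sigma1 p}"

definition PFUN :: "fm \<Rightarrow> dfm" where
  "PFUN p = (\<^bold>\<forall>x. \<^bold>\<forall>y. \<^bold>\<forall>y'. app2 p x y \<^bold>\<and> app2 p x y' \<^bold>\<longrightarrow> y \<^bold>= y')"

definition Approx :: "fm \<Rightarrow> dtm \<Rightarrow> dfm" where
  "Approx p s = (Seq s \<^bold>\<and>
     (\<^bold>\<forall>i. \<^bold>\<forall>u. \<^bold>\<forall>v. Entry s i u \<^bold>\<and> Entry s (i \<^bold>+ \<^bold>1) v \<^bold>\<longrightarrow>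
       (\<^bold>\<forall>x. \<^bold>\<forall>y. x \<^bold>\<le> u \<^bold>\<and> app2 p x y \<^bold>\<longrightarrow> y \<^bold>\<le> v)))"

definition IterationP :: "fm \<Rightarrow> fm" where
  "IterationP p = sentence (PFUN p \<^bold>\<longrightarrow> (\<^bold>\<forall>z. \<^bold>\<exists>s. Approx p s \<^bold>\<and> Lth s z))"

definition PSigma1 :: "fm set" where
  "PSigma1 = ISigma1 \<union> {IterationP p | p. Sigma1 p}"


section \<open>Monotone enumerations\<close>

text \<open>Below, \<open>E\<close> is a formula whose instance \<open>E(s,y)\<close> (see \<^const>\<open>app2\<close>) says that \<open>y\<close> is the code of
  the finite set \<open>E[s]\<close>; it may contain parameters.\<close>

definition IsEnum :: "fm \<Rightarrow> dfm" where
  "IsEnum E = (\<^bold>\<forall>s. (\<^bold>\<exists>y. app2 E s y \<^bold>\<and> FinSet y) \<^bold>\<and>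
     (\<^bold>\<forall>y. \<^bold>\<forall>y'. app2 E s y \<^bold>\<and> app2 E s y' \<^bold>\<longrightarrow> y \<^bold>= y'))"

text \<open>\<open>t \<in> E[s]\<close>\<close>

definition InStage :: "fm \<Rightarrow> dtm \<Rightarrow> dtm \<Rightarrow> dfm" where
  "InStage E t s = (\<^bold>\<exists>y. app2 E s y \<^bold>\<and> Mem t y)"

text \<open>\<open>t \<in> E[s] - E[s-1]\<close>, where the first stage is 0 and \<open>E[-1]\<close> is empty.\<close>

definition EnumAt :: "fm \<Rightarrow> dtm \<Rightarrow> dtm \<Rightarrow> dfm" where
  "EnumAt E t s = (InStage E t s \<^bold>\<and> \<^bold>\<not> (\<^bold>\<exists>r. r \<^bold>+ \<^bold>1 \<^bold>= s \<^bold>\<and> InStage E t r))"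

definition EnumBefore :: "fm \<Rightarrow> dtm \<Rightarrow> dtm \<Rightarrow> dfm" where
  "EnumBefore E t s = (\<^bold>\<exists>r. r \<^bold>< s \<^bold>\<and> EnumAt E t r)"

definition InTree :: "fm \<Rightarrow> dtm \<Rightarrow> dfm" where
  "InTree E t = (\<^bold>\<exists>s. \<^bold>\<exists>u. InStage E u s \<^bold>\<and> Initseg t u)"

text \<open>\<open>t0\<close> is the longest initial segment of \<open>t\<close> enumerated at a stage prior to \<open>s\<close>.\<close>

definition LongestBefore :: "fm \<Rightarrow> dtm \<Rightarrow> dtm \<Rightarrow> dtm \<Rightarrow> dfm" where
  "LongestBefore E t0 t s = (Initseg t0 t \<^bold>\<and> EnumBefore E t0 s \<^bold>\<and>
     (\<^bold>\<forall>u. Initseg u t \<^bold>\<and> EnumBefore E u s \<^bold>\<longrightarrow>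
       (\<^bold>\<forall>m. \<^bold>\<forall>n. Lth u m \<^bold>\<and> Lth t0 n \<^bold>\<longrightarrow> m \<^bold>\<le> n)))"

text \<open>In (3a) extensions are proper ones, as \<open>t0\<close> itself was enumerated before stage \<open>s\<close>.\<close>

definition MonotoneEnum :: "fm \<Rightarrow> dfm" where
  "MonotoneEnum E =
    (IsEnum E \<^bold>\<and>
     (\<^bold>\<forall>s. \<^bold>\<forall>t. InStage E t s \<^bold>\<longrightarrow> InStage E t (s \<^bold>+ \<^bold>1)) \<^bold>\<and>
     (\<^bold>\<exists>t. Lth t \<^bold>0 \<^bold>\<and> EnumAt E t \<^bold>0) \<^bold>\<and>
     (\<^bold>\<forall>s. IsFinite (\<lambda>t. EnumAt E t s)) \<^bold>\<and>
     (\<^bold>\<forall>s. \<^bold>\<forall>t. \<^bold>\<forall>t0. EnumAt E t s \<^bold>\<and> LongestBefore E t0 t s \<^bold>\<longrightarrow>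
       \<^bold>\<not> (\<^bold>\<exists>u. Initseg t0 u \<^bold>\<and> \<^bold>\<not> SeqEq u t0 \<^bold>\<and> EnumBefore E u s) \<^bold>\<and>
       (\<^bold>\<forall>u. EnumAt E u s \<^bold>\<longrightarrow> Initseg t0 u)))"

text \<open>\<open>c\<close> codes the stage-by-stage sequence of \<open>t\<close>.\<close>

definition StageByStage :: "fm \<Rightarrow> dtm \<Rightarrow> dtm \<Rightarrow> dfm" where
  "StageByStage E c t =
    (Entry c \<^bold>0 t \<^bold>\<and>
     (\<^bold>\<forall>i. \<^bold>\<forall>u. \<^bold>\<forall>v. Entry c i u \<^bold>\<and> Entry c (i \<^bold>+ \<^bold>1) v \<^bold>\<longrightarrow>
       (\<^bold>\<exists>s. EnumAt E u s \<^bold>\<and> LongestBefore E v u s)) \<^bold>\<and>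
     (\<^bold>\<exists>n. \<^bold>\<exists>v. Lth c (n \<^bold>+ \<^bold>1) \<^bold>\<and> Entry c n v \<^bold>\<and> Lth v \<^bold>0))"

definition BoundedBy :: "fm \<Rightarrow> dtm \<Rightarrow> dfm" where
  "BoundedBy E b = (\<^bold>\<forall>t. (\<^bold>\<exists>s. InStage E t s) \<^bold>\<longrightarrow>
     (\<^bold>\<exists>c. \<^bold>\<exists>n. StageByStage E c t \<^bold>\<and> Lth c n \<^bold>\<and> n \<^bold>\<le> b))"

definition BME :: "fm \<Rightarrow> fm" where
  "BME E = sentence
     (MonotoneEnum E \<^bold>\<longrightarrow> (\<^bold>\<forall>b. BoundedBy E b \<^bold>\<longrightarrow> IsFinite (InTree E)))"

text \<open>Over elementary arithmetic, a quantifier-free definition is one without unbounded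
  quantifiers; in the signature used here these are the \<^const>\<open>Delta0\<close> formulas.\<close>

definition BME_star :: "fm set" where
  "BME_star = {BME E | E. Delta0 E}"

end

(* By completeness it suffices to verify BME_* in an arbitrary model of P Sigma_1. There, call the
   expansion stage of an enumerated sequence x the first stage s at which a proper extension of x is
   enumerated. The partial function taking x to <s, E[s]> has a Sigma_1 graph, and by condition (3a)
   every sequence whose stage-by-stage predecessor is x is enumerated at the expansion stage of x, so
   it has a code below <s, E[s]>. Hence, if E is bounded by b, an approximation of length b to the
   iteration of this function bounds the stages at which sequences are enumerated, starting from 0,
   the code of the empty sequence. The tree then consists of the initial segments of the members of a
   single E[s], and these can be listed by truncating codes. *)

theory Submission
  imports Defs "HOL-Library.Countable"
begin

text \<open>Working in a model trades formal derivations for ordinary reasoning, but induction there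
  is available only for Sigma_1 predicates with parameters. This shapes the proof: every predicate
  used in an induction is first shown to be \<open>sigma\<close>, bounded quantifiers are absorbed
  by collection, and negations are rewritten positively through the uniqueness of E[s]. A sequence
  has many codes and the iteration principle compares numbers, so what is carried along is that some
  code of the sequence lies below the current value. That is why the iterated function returns E[s]
  together with s: the next argument must be dominated as a number, and the code of a finite set
  bounds the listed codes of its members. Stage-by-stage sequences run down to the empty sequence
  while the iteration runs upwards, so the two are compared with indices reversed. Listing truncated
  codes requires the Chinese remainder theorem in the model, proved by Sigma_1 induction with a
  common multiple in place of the factorial.\<close>

instance tm :: countable by countable_datatype

text \<open>Numbers all formulas, so that a maximal consistent set can be built in countably many
  steps.\<close>

instance fm :: countable by countable_datatype

section \<open>Substitution\<close>

abbreviation cons :: "'a \<Rightarrow> (nat \<Rightarrow> 'a) \<Rightarrow> nat \<Rightarrow> 'a" (infixr "##" 65)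
  where "a ## e \<equiv> case_nat a e"

abbreviation up :: "(nat \<Rightarrow> tm) \<Rightarrow> nat \<Rightarrow> tm"
  where "up f \<equiv> Var 0 ## (\<lambda>k. lift_tm (f k))"

lemma subst_tm_subst_tm: "subst_tm f (subst_tm g t) = subst_tm (\<lambda>k. subst_tm f (g k)) t"
  by (induction t) auto

lemma subst_tm_lift_tm: "subst_tm f (lift_tm t) = subst_tm (\<lambda>k. f (Suc k)) t"
  by (simp add: lift_tm_def subst_tm_subst_tm)

lemma lift_tm_subst_tm: "lift_tm (subst_tm f t) = subst_tm (\<lambda>k. lift_tm (f k)) t"
  by (simp add: lift_tm_def subst_tm_subst_tm)

lemma subst_tm_up: "subst_tm (up f) (up g k) = up (\<lambda>k. subst_tm f (g k)) k"
  by (cases k) (auto simp: subst_tm_lift_tm lift_tm_subst_tm)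

lemma subst_subst: "subst f (subst g p) = subst (\<lambda>k. subst_tm f (g k)) p"
  by (induction p arbitrary: f g) (simp_all add: subst_tm_subst_tm subst_tm_up)

lemma up_Var: "up Var = Var"
  by (rule ext) (auto simp: lift_tm_def split: nat.split)

lemma subst_tm_Var [simp]: "subst_tm Var t = t"
  by (induction t) auto

lemma subst_Var [simp]: "subst Var p = p"
  by (induction p) (simp_all add: up_Var)

lemma subst_tm_cong:
  "(\<And>k. k < bound_tm t \<Longrightarrow> f k = g k) \<Longrightarrow> subst_tm f t = subst_tm g t"
  by (induction t) auto

text \<open>The quantifier case works because \<open>bound\<close> drops by one exactly where
  \<open>up\<close> shifts by one. With bound zero this makes axioms invariant under
  substitution.\<close>

lemma subst_cong:
  "(\<And>k. k < bound p \<Longrightarrow> f k = g k) \<Longrightarrow> subst f p = subst g p"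
proof (induction p arbitrary: f g)
  case (All p)
  have "up f k = up g k" if "k < bound p" for k
    using that All.prems by (cases k) auto
  then show ?case using All.IH[of "up f" "up g"] by simp
next
  case (Eq t u)
  then show ?case by (simp add: subst_tm_cong[of t f g] subst_tm_cong[of u f g])
next
  case (Less t u)
  then show ?case by (simp add: subst_tm_cong[of t f g] subst_tm_cong[of u f g])
next
  case (Imp p q)
  have "subst f p = subst g p" by (rule Imp.IH(1)) (simp add: Imp.prems)
  moreover have "subst f q = subst g q" by (rule Imp.IH(2)) (simp add: Imp.prems)
  ultimately show ?case by simp
qed simp

lemma subst_sentence:
  assumes "bound p = 0"
  shows "subst f p = p"
  using subst_cong[of p f Var] assms by simp

lemma subst_inst: "subst f (inst p t) = inst (subst (up f) p) (subst_tm f t)"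
proof -
  have "subst_tm f ((t ## Var) k) = subst_tm (subst_tm f t ## Var) (up f k)" for k
    by (cases k) (auto simp: subst_tm_lift_tm)
  then show ?thesis by (simp add: inst_def subst_subst)
qed

lemma inst_subst_up: "inst (subst (up f) p) t = subst (t ## f) p"
proof -
  have "subst_tm (t ## Var) (up f k) = (t ## f) k" for k
    by (cases k) (auto simp: subst_tm_lift_tm)
  then show ?thesis by (simp add: inst_def subst_subst)
qed

lemma subst_lift: "subst (up f) (lift p) = lift (subst f p)"
  by (simp add: lift_def subst_subst lift_tm_def)

lemma bound_funpow_All: "bound ((All ^^ n) p) = bound p - n"
  by (induction n) auto

lemma bound_sentence [simp]: "bound (sentence p) = 0"
  by (simp add: sentence_def univ_closure_def bound_funpow_All)

section \<open>Derivations from hypotheses\<close>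

text \<open>Each axiom scheme is closed under substitution and the members of \<open>T\<close> are
  sentences. Free variables of a theorem can therefore be renamed, as their use as Henkin constants
  requires.\<close>

lemma proves_subst:
  assumes "T \<turnstile> p" "\<And>q. q \<in> T \<Longrightarrow> bound q = 0"
  shows "T \<turnstile> subst f p"
  using assms(1)
proof (induction arbitrary: f)
  case (Ax p)
  then show ?case using assms(2) by (simp add: subst_sentence proves.Ax)
next
  case (DN p)
  then show ?case using proves.DN[of T "subst f p"] by (simp add: Neg_def)
next
  case (Inst p t)
  then show ?case using proves.Inst[of T "subst (up f) p" "subst_tm f t"]
    by (simp add: subst_inst)
next
  case (Dist p q)
  then show ?case using proves.Dist[of T "subst f p" "subst (up f) q"]
    by (simp add: subst_lift)
next
  case (Leibniz t u p)
  then show ?case using proves.Leibniz[of T "subst_tm f t" "subst_tm f u" "subst (up f) p"]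
    by (simp add: subst_inst)
next
  case (MP p q)
  then show ?case by (metis proves.MP subst.simps(4))
qed (auto intro: proves.intros)

text \<open>The elements of \<open>G\<close> may have free variables, which act as constants: only theorems of \<open>T\<close>
  are generalized.\<close>

inductive entails :: "fm set \<Rightarrow> fm set \<Rightarrow> fm \<Rightarrow> bool" for T G where
  hyp: "p \<in> G \<Longrightarrow> entails T G p"
| prv: "T \<turnstile> p \<Longrightarrow> entails T G p"
| mp: "entails T G (Imp p q) \<Longrightarrow> entails T G p \<Longrightarrow> entails T G q"

lemma proves_Imp_refl: "T \<turnstile> Imp p p"
  by (meson proves.K proves.S proves.MP)

lemma entails_mono: "entails T G p \<Longrightarrow> G \<subseteq> H \<Longrightarrow> entails T H p"
  by (induction rule: entails.induct) (auto intro: entails.intros)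

lemma entails_empty: "entails T {} p \<Longrightarrow> T \<turnstile> p"
  by (induction rule: entails.induct) (auto intro: proves.MP)

text \<open>No side condition on variables arises: hypotheses are only combined by modus ponens, and
  generalization is confined to derivations of theorems.\<close>

lemma deduction: "entails T (insert q G) p \<Longrightarrow> entails T G (Imp q p)"
proof (induction rule: entails.induct)
  case (hyp p)
  then show ?case
    by (metis entails.hyp entails.mp entails.prv insertE proves.K proves_Imp_refl)
next
  case (prv p)
  then show ?case by (meson entails.prv entails.mp proves.K)
next
  case (mp p r)
  then show ?case by (meson entails.prv entails.mp proves.S)
qed

lemma deduction_iff: "entails T G (Imp q p) \<longleftrightarrow> entails T (insert q G) p"
  by (meson deduction entails.hyp entails.mp entails_mono insertI1 subset_insertI)

lemma entails_Bot: "entails T G Bot \<Longrightarrow> entails T G p"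
  by (metis Neg_def deduction_iff entails.mp entails.prv entails_mono proves.DN subset_insertI)

lemma entails_contr: "entails T (insert (Neg p) G) Bot \<Longrightarrow> entails T G p"
  by (metis Neg_def deduction entails.mp entails.prv proves.DN)

lemma entails_subst:
  assumes "entails T G p" "\<And>q. q \<in> T \<Longrightarrow> bound q = 0"
  shows "entails T (subst f ` G) (subst f p)"
  using assms(1)
  by (induction rule: entails.induct)
    (auto intro: entails.intros proves_subst assms(2))

text \<open>The hypotheses are discharged one at a time and moved past the quantifier by
  \<open>Dist\<close>, hence the induction on a finite set.\<close>

lemma entails_Gen:
  assumes "finite G" "entails T (lift ` G) p"
  shows "entails T G (All p)"
  using assms
proof (induction arbitrary: p)
  case empty
  then show ?case by (simp add: entails.prv entails_empty proves.Gen)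
next
  case (insert q G)
  then have "entails T G (All (Imp (lift q) p))" by (simp add: deduction)
  then have "entails T G (Imp q (All p))" by (meson entails.mp entails.prv proves.Dist)
  then show ?case by (simp add: deduction_iff)
qed

text \<open>A derivation uses finitely many hypotheses, all of which already occur at one stage of
  the chain.\<close>

lemma entails_Union_chain:
  assumes "entails T (\<Union>n. G n) p" "\<And>n. G n \<subseteq> G (Suc n)"
  shows "\<exists>n. entails T (G n) p"
  using assms(1)
proof (induction rule: entails.induct)
  case (mp p q)
  then obtain m n where "entails T (G m) (Imp p q)" "entails T (G n) p" by blast
  moreover have "G m \<subseteq> G (max m n)" "G n \<subseteq> G (max m n)"
    by (simp_all add: assms(2) lift_Suc_mono_le)
  ultimately show ?case by (meson entails.mp entails_mono)
qed (auto intro: entails.intros)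

section \<open>Henkin sets\<close>

text \<open>The clauses are those of a truth definition for \<open>Bot\<close>, \<open>Imp\<close>
  and \<open>All\<close>, so membership in \<open>D\<close> can be matched with satisfaction by
  induction on formulas. Maximality is contained in the \<open>Imp\<close> clause, taken with
  \<open>q = Bot\<close>.\<close>

definition henkin :: "fm set \<Rightarrow> fm set \<Rightarrow> bool" where
  "henkin T D \<longleftrightarrow> (\<forall>p. T \<turnstile> p \<longrightarrow> p \<in> D) \<and> Bot \<notin> D \<and>
     (\<forall>p q. Imp p q \<in> D \<longleftrightarrow> (p \<in> D \<longrightarrow> q \<in> D)) \<and>
     (\<forall>p. All p \<in> D \<longleftrightarrow> (\<forall>t. inst p t \<in> D))"

text \<open>A fresh variable serves as the Henkin constant.\<close>

lemma Henkin_witness: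
  assumes fin: "finite G" and T: "\<And>q. q \<in> T \<Longrightarrow> bound q = 0"
    and con: "\<not> entails T G Bot" and q: "Neg (All q) \<in> G"
  shows "\<exists>k. \<not> entails T (insert (Neg (inst q (Var k))) G) Bot"
proof -
  obtain k where k: "\<And>p. p \<in> G \<Longrightarrow> bound p < k"
    using finite_nat_set_iff_bounded[of "bound ` G"] fin by auto
  \<comment> \<open>Sends \<open>k\<close> to the new bound variable and shifts everything else, so
    it agrees with \<open>lift\<close> on formulas in which \<open>k\<close> is fresh and turns the
    instance at \<open>k\<close> back into the matrix \<open>q\<close>.\<close>
  let ?f = "\<lambda>j. if j = k then Var 0 else Var (Suc j)"
  have bq: "bound q \<le> k" using k[OF q] by (simp add: Neg_def)
  have lift: "subst ?f p = lift p" if "p \<in> G" for p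
    unfolding lift_def using k[OF that] by (intro subst_cong) auto
  have "subst ?f (inst q (Var k)) = subst (\<lambda>j. subst_tm ?f ((Var k ## Var) j)) q"
    by (simp add: inst_def subst_subst)
  also have "\<dots> = subst Var q"
    by (rule subst_cong) (use bq in \<open>auto split: nat.split\<close>)
  finally have inst: "subst ?f (inst q (Var k)) = q" by simp
  have "\<not> entails T (insert (Neg (inst q (Var k))) G) Bot"
  proof
    assume "entails T (insert (Neg (inst q (Var k))) G) Bot"
    from entails_subst[OF entails_contr[OF this] T, of ?f]
    have "entails T (lift ` G) q" using lift by (simp add: inst cong: image_cong)
    then have "entails T G (All q)" by (rule entails_Gen[OF fin])
    then show False using con q by (metis Neg_def entails.hyp entails.mp)
  qed
  then show ?thesis ..
qed

text \<open>Lindenbaum's construction: formula number \<open>n\<close> is decided at step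
  \<open>n\<close>. The stages stay finite, which guarantees a fresh variable for each
  witness.\<close>

lemma henkin_exists:
  assumes T: "\<And>q. q \<in> T \<Longrightarrow> bound q = 0" and con: "\<not> T \<turnstile> Bot"
  obtains D where "henkin T D"
proof -
  define good where "good n G \<longleftrightarrow> finite G \<and> \<not> entails T G Bot" for n :: nat and G
  define succ where "succ n G H \<longleftrightarrow> G \<subseteq> H \<and>
    (from_nat n \<in> H \<or> entails T H (Neg (from_nat n))) \<and>
    (\<forall>q. from_nat n = Neg (All q) \<and> Neg (All q) \<in> H \<longrightarrow> (\<exists>k. Neg (inst q (Var k)) \<in> H))"
    for n and G H :: "fm set"
  have "\<exists>H. good (Suc n) H \<and> succ n G H" if G: "good n G" for n G
  proof (cases "entails T (insert (from_nat n) G) Bot")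
    case True
    then have e: "entails T G (Neg (from_nat n))" unfolding Neg_def by (rule deduction)
    then have "Neg (All q) \<notin> G" if "from_nat n = Neg (All q)" for q
      using G that by (metis Neg_def entails.hyp entails.mp good_def)
    with e G show ?thesis by (auto simp: good_def succ_def intro: exI[of _ G])
  next
    case False
    show ?thesis
    proof (cases "\<exists>q. from_nat n = Neg (All q)")
      case True
      then obtain q where q: "from_nat n = Neg (All q)" by blast
      obtain k where "\<not> entails T (insert (Neg (inst q (Var k))) (insert (from_nat n) G)) Bot"
        using Henkin_witness[OF _ T False] G q by (auto simp: good_def)
      then show ?thesis using G q
        by (intro exI[of _ "insert (Neg (inst q (Var k))) (insert (from_nat n) G)"])
          (auto simp: good_def succ_def Neg_def)
    qed (use False G in \<open>auto simp: good_def succ_def intro: exI[of _ "insert (from_nat n) G"]\<close>)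
  qed
  moreover have "good 0 {}" using con entails_empty by (auto simp: good_def)
  ultimately obtain G where good: "\<And>n. good n (G n)" and step: "\<And>n. succ n (G n) (G (Suc n))"
    using dependent_nat_choice[of good succ] by blast
  define D where "D = (\<Union>n. G n)"
  have conD: "\<not> entails T D Bot"
    using entails_Union_chain[of T G Bot] good step by (auto simp: D_def good_def succ_def)
  have sub: "G n \<subseteq> D" for n by (auto simp: D_def)
  have max: "p \<in> D \<or> entails T D (Neg p)" for p
    using step[of "to_nat p"] sub[of "Suc (to_nat p)"] entails_mono[of T _ _ D]
    by (auto simp: succ_def)
  have closed: "p \<in> D \<longleftrightarrow> entails T D p" for p
    using max[of p] conD by (metis Neg_def entails.hyp entails.mp)
  have wit: "\<exists>k. Neg (inst q (Var k)) \<in> D" if "Neg (All q) \<in> D" for q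
  proof -
    \<comment> \<open>A formula of \<open>D\<close> is already present after the step that decided
      it, for otherwise that stage would entail its negation. The same step supplied its
      witness.\<close>
    let ?n = "to_nat (Neg (All q))"
    have "Neg (All q) \<in> G (Suc ?n)"
      using step[of ?n] that conD closed sub[of "Suc ?n"] entails_mono[of T _ _ D]
      by (auto simp: succ_def) (metis Neg_def entails.hyp entails.mp)
    then show ?thesis using step[of ?n] sub[of "Suc ?n"] unfolding succ_def from_nat_to_nat by blast
  qed
  have neg: "Neg p \<in> D \<longleftrightarrow> p \<notin> D" for p
    using max[of p] closed conD by (metis Neg_def entails.mp)
  have "henkin T D"
    unfolding henkin_def
  proof (intro conjI allI impI iffI)
    show "p \<in> D" if "T \<turnstile> p" for p using that closed entails.prv by blast
    show "Bot \<notin> D" using conD closed by blast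
    show "q \<in> D" if "Imp p q \<in> D" "p \<in> D" for p q using that closed entails.mp by blast
    show "Imp p q \<in> D" if "p \<in> D \<longrightarrow> q \<in> D" for p q
    proof (cases "p \<in> D")
      case True
      then show ?thesis using that closed by (meson deduction entails_mono subset_insertI)
    next
      case False
      then have "entails T (insert p D) Bot"
        using neg closed by (metis Neg_def deduction_iff)
      then show ?thesis using closed entails_Bot deduction by blast
    qed
    show "inst p t \<in> D" if "All p \<in> D" for p t
      using that closed by (meson entails.mp entails.prv proves.Inst)
    show "All p \<in> D" if "\<forall>t. inst p t \<in> D" for p
      using that wit[of p] neg by blast
  qed
  then show thesis ..
qed

section \<open>Semantics\<close>

primrec sem_tm :: "(nat \<Rightarrow> 'a::{zero,one,plus,times,ord}) \<Rightarrow> tm \<Rightarrow> 'a" where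
  "sem_tm e (Var k) = e k"
| "sem_tm e Zero = 0"
| "sem_tm e One = 1"
| "sem_tm e (Add t u) = sem_tm e t + sem_tm e u"
| "sem_tm e (Mul t u) = sem_tm e t * sem_tm e u"

primrec sem :: "(nat \<Rightarrow> 'a::{zero,one,plus,times,ord}) \<Rightarrow> fm \<Rightarrow> bool" where
  "sem e Bot \<longleftrightarrow> False"
| "sem e (Eq t u) \<longleftrightarrow> sem_tm e t = sem_tm e u"
| "sem e (Less t u) \<longleftrightarrow> sem_tm e t < sem_tm e u"
| "sem e (Imp p q) \<longleftrightarrow> (sem e p \<longrightarrow> sem e q)"
| "sem e (All p) \<longleftrightarrow> (\<forall>x. sem (x ## e) p)"

lemma sem_connectives [simp]:
  "sem e (Neg p) \<longleftrightarrow> \<not> sem e p"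
  "sem e (Ex p) \<longleftrightarrow> (\<exists>x. sem (x ## e) p)"
  "sem e (Con p q) \<longleftrightarrow> sem e p \<and> sem e q"
  "sem e (Dis p q) \<longleftrightarrow> sem e p \<or> sem e q"
  by (auto simp: Neg_def Ex_def Con_def Dis_def)

lemma sem_subst_tm: "sem_tm e (subst_tm f t) = sem_tm (\<lambda>k. sem_tm e (f k)) t"
  by (induction t) auto

lemma sem_lift_tm [simp]: "sem_tm (x ## e) (lift_tm t) = sem_tm e t"
  by (simp add: lift_tm_def sem_subst_tm)

lemma sem_up: "(\<lambda>k. sem_tm (x ## e) (up f k)) = x ## (\<lambda>k. sem_tm e (f k))"
  by (rule ext) (simp split: nat.split)

lemma sem_subst: "sem e (subst f p) \<longleftrightarrow> sem (\<lambda>k. sem_tm e (f k)) p"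
  by (induction p arbitrary: e f) (simp_all add: sem_subst_tm sem_up)

lemma sem_lift: "sem (x ## e) (lift p) \<longleftrightarrow> sem e p"
  by (simp add: lift_def sem_subst)

lemma sem_inst: "sem e (inst p t) \<longleftrightarrow> sem (sem_tm e t ## e) p"
proof -
  have "(\<lambda>k. sem_tm e ((t ## Var) k)) = sem_tm e t ## e"
    by (rule ext) (simp split: nat.split)
  then show ?thesis by (simp add: inst_def sem_subst)
qed

lemma soundness:
  assumes "T \<turnstile> p" "\<And>q (e :: nat \<Rightarrow> 'a::{zero,one,plus,times,ord}). q \<in> T \<Longrightarrow> sem e q"
  shows "sem (e :: nat \<Rightarrow> 'a) p"
  using assms(1)
  by (induction arbitrary: e) (auto simp: assms(2) sem_inst sem_lift)

text \<open>Every assignment has the form \<open>x ## e\<close>, so under quantification over all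
  assignments a further \<open>All\<close> changes nothing. This removes the universal closure from
  sentences.\<close>

lemma sem_funpow_All:
  "(\<forall>e. sem (e :: nat \<Rightarrow> 'a::{zero,one,plus,times,ord}) ((All ^^ n) p)) \<longleftrightarrow> (\<forall>e :: nat \<Rightarrow> 'a. sem e p)"
proof (induction n)
  case (Suc n)
  have "(\<forall>(e :: nat \<Rightarrow> 'a) x. sem (x ## e) q) \<longleftrightarrow> (\<forall>e :: nat \<Rightarrow> 'a. sem e q)" for q
  proof (intro iffI allI)
    fix e :: "nat \<Rightarrow> 'a"
    assume "\<forall>(e :: nat \<Rightarrow> 'a) x. sem (x ## e) q"
    then have "sem (e 0 ## (\<lambda>k. e (Suc k))) q" by blast
    moreover have "e 0 ## (\<lambda>k. e (Suc k)) = e" by (rule ext) (simp split: nat.split)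
    ultimately show "sem e q" by simp
  qed simp
  with Suc show ?case by simp
qed simp

lemma sem_sentence:
  "(\<forall>e. sem (e :: nat \<Rightarrow> 'a::{zero,one,plus,times,ord}) (sentence p)) \<longleftrightarrow> (\<forall>e :: nat \<Rightarrow> 'a. sem e (p 0))"
  by (simp add: sentence_def univ_closure_def sem_funpow_All)

text \<open>Stability makes the value of an argument of a defined formula independent of the depth at
  which the definition uses it.\<close>

definition stable :: "nat \<Rightarrow> dtm \<Rightarrow> bool" where
  "stable d s \<longleftrightarrow> (\<forall>d' \<ge> d. s (Suc d') = lift_tm (s d'))"

lemma stableD: "stable d s \<Longrightarrow> sem_tm (x ## e) (s (Suc d)) = sem_tm e (s d)"
  by (simp add: stable_def)

lemma stable_Suc: "stable d s \<Longrightarrow> stable (Suc d) s"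
  by (simp add: stable_def)

lemma stable_bound [simp]: "d < n \<Longrightarrow> stable n (\<lambda>d'. Var (d' - Suc d))"
  by (auto simp: stable_def lift_tm_def)

lemma stable_ops [simp]:
  "stable d \<^bold>0" "stable d \<^bold>1"
  "stable d x \<Longrightarrow> stable d y \<Longrightarrow> stable d (x \<^bold>+ y)"
  "stable d x \<Longrightarrow> stable d y \<Longrightarrow> stable d (x \<^bold>* y)"
  by (simp_all add: stable_def dZero_def dOne_def dAdd_def dMul_def lift_tm_def)

lemma sem_dtm [simp]:
  "sem_tm e (\<^bold>0 d) = 0" "sem_tm e (\<^bold>1 d) = 1"
  "sem_tm e ((x \<^bold>+ y) d) = sem_tm e (x d) + sem_tm e (y d)"
  "sem_tm e ((x \<^bold>* y) d) = sem_tm e (x d) * sem_tm e (y d)"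
  by (simp_all add: dZero_def dOne_def dAdd_def dMul_def)

lemma sem_dfm [simp]:
  "sem e ((x \<^bold>= y) d) \<longleftrightarrow> sem_tm e (x d) = sem_tm e (y d)"
  "sem e ((x \<^bold>< y) d) \<longleftrightarrow> sem_tm e (x d) < sem_tm e (y d)"
  "sem e ((\<^bold>\<not> p) d) \<longleftrightarrow> \<not> sem e (p d)"
  "sem e ((p \<^bold>\<and> q) d) \<longleftrightarrow> sem e (p d) \<and> sem e (q d)"
  "sem e ((p \<^bold>\<or> q) d) \<longleftrightarrow> sem e (p d) \<or> sem e (q d)"
  "sem e ((p \<^bold>\<longrightarrow> q) d) \<longleftrightarrow> (sem e (p d) \<longrightarrow> sem e (q d))"
  "sem e ((p \<^bold>\<longleftrightarrow> q) d) \<longleftrightarrow> (sem e (p d) \<longleftrightarrow> sem e (q d))"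
  "sem e (dAll P d) \<longleftrightarrow> (\<forall>a. sem (a ## e) (P (\<lambda>d'. Var (d' - Suc d)) (Suc d)))"
  "sem e (dEx P d) \<longleftrightarrow> (\<exists>a. sem (a ## e) (P (\<lambda>d'. Var (d' - Suc d)) (Suc d)))"
  by (auto simp: dEq_def dLess_def dNot_def dAnd_def dOr_def dImp_def dIff_def dAll_def dEx_def)

lemma sem_dLe [simp]:
  "sem (e :: nat \<Rightarrow> 'a::{zero,one,plus,times,linorder}) ((x \<^bold>\<le> y) d) \<longleftrightarrow> sem_tm e (x d) \<le> sem_tm e (y d)"
  by (auto simp: dLe_def)

lemma sem_app1:
  "sem e (app1 p x d) \<longleftrightarrow> sem (sem_tm e (x d) ## (\<lambda>k. e (k + d))) p"
  unfolding app1_def sem_subst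
  by (rule arg_cong[of _ _ "\<lambda>e. sem e p"], rule ext) (simp split: nat.split)

lemma sem_app2:
  "sem e (app2 p x y d) \<longleftrightarrow> sem (sem_tm e (x d) ## sem_tm e (y d) ## (\<lambda>k. e (k + d))) p"
  unfolding app2_def sem_subst
  by (rule arg_cong[of _ _ "\<lambda>e. sem e p"], rule ext) (simp split: nat.split)

text \<open>Used in both directions: to check that the natural numbers are a model, and to read the
  axioms off the term model.\<close>

lemma Pminus_valid_iff:
  "(\<forall>p \<in> Pminus. \<forall>e :: nat \<Rightarrow> 'a::{zero,one,plus,times,ord}. sem e p) \<longleftrightarrow>
     (\<forall>x y z :: 'a. (x + y) + z = x + (y + z)) \<and> (\<forall>x y :: 'a. x + y = y + x) \<and>
     (\<forall>x y z :: 'a. (x * y) * z = x * (y * z)) \<and> (\<forall>x y :: 'a. x * y = y * x) \<and>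
     (\<forall>x y z :: 'a. x * (y + z) = x * y + x * z) \<and>
     (\<forall>x :: 'a. x + 0 = x) \<and> (\<forall>x :: 'a. x * 0 = 0) \<and> (\<forall>x :: 'a. x * 1 = x) \<and>
     (\<forall>x y z :: 'a. x < y \<and> y < z \<longrightarrow> x < z) \<and> (\<forall>x :: 'a. \<not> x < x) \<and>
     (\<forall>x y :: 'a. x < y \<or> x = y \<or> y < x) \<and>
     (\<forall>x y z :: 'a. x < y \<longrightarrow> x + z < y + z) \<and>
     (\<forall>x y z :: 'a. 0 < z \<and> x < y \<longrightarrow> x * z < y * z) \<and>
     (\<forall>x y :: 'a. x < y \<longrightarrow> (\<exists>z. x + z = y)) \<and> (0 :: 'a) < 1 \<and>
     (\<forall>x :: 'a. 0 < x \<longrightarrow> 1 < x \<or> 1 = x) \<and> (\<forall>x :: 'a. 0 < x \<or> 0 = x)"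
  unfolding Pminus_def ball_simps sem_sentence by (simp add: dLe_def)

section \<open>A term model\<close>

text \<open>A sentence is unchanged by lifting, so generalizations inside the derivation survive
  when the added axiom is treated as a hypothesis.\<close>

lemma proves_insert:
  assumes "insert q T \<turnstile> p" "bound q = 0"
  shows "entails T {q} p"
  using assms(1)
proof (induction rule: proves.induct)
  case (Ax p)
  then show ?case by (auto intro: entails.hyp entails.prv proves.Ax)
next
  case (Gen p)
  then show ?case using entails_Gen[of "{q}" T p] assms(2) by (simp add: lift_def subst_sentence)
qed (blast intro: entails.intros proves.intros)+

context
  fixes T D :: "fm set"
  assumes D: "henkin T D"
begin

section \<open>Equality and congruence in a Henkin set\<close>

lemma henkin_proves: "T \<turnstile> p \<Longrightarrow> p \<in> D"
  using D by (auto simp: henkin_def)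

lemma henkin_Imp: "Imp p q \<in> D \<longleftrightarrow> (p \<in> D \<longrightarrow> q \<in> D)"
  using D unfolding henkin_def by blast

lemma henkin_Bot: "Bot \<notin> D"
  using D by (auto simp: henkin_def)

lemma henkin_All: "All p \<in> D \<longleftrightarrow> (\<forall>t. inst p t \<in> D)"
  using D unfolding henkin_def by blast

lemma henkin_eq_refl: "Eq t t \<in> D"
  by (rule henkin_proves) (rule proves.Refl)

lemma henkin_Leibniz: "Eq t u \<in> D \<Longrightarrow> inst p t \<in> D \<Longrightarrow> inst p u \<in> D"
  using henkin_proves[OF proves.Leibniz[of T t u p]] henkin_Imp by blast

lemma inst_tm_lift [simp]: "subst_tm (t ## Var) (lift_tm u) = u"
  by (simp add: subst_tm_lift_tm)

lemma henkin_eq_sym: "Eq t u \<in> D \<Longrightarrow> Eq u t \<in> D"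
  using henkin_Leibniz[of t u "Eq (Var 0) (lift_tm t)"] henkin_eq_refl by (simp add: inst_def)

lemma henkin_eq_trans: "Eq t u \<in> D \<Longrightarrow> Eq u v \<in> D \<Longrightarrow> Eq t v \<in> D"
  using henkin_Leibniz[of u v "Eq (lift_tm t) (Var 0)"] by (simp add: inst_def)

lemma henkin_eq_equivp: "equivp (\<lambda>t u. Eq t u \<in> D)"
  using henkin_eq_refl henkin_eq_sym henkin_eq_trans
  by (intro equivpI reflpI sympI transpI) blast+

text \<open>Leibniz replaces one argument at a time; lifting the other terms keeps them clear of the
  variable that marks the place of replacement.\<close>

lemma henkin_eq_cong:
  assumes "Eq t t' \<in> D" "Eq u u' \<in> D"
  shows "Eq (Add t u) (Add t' u') \<in> D" "Eq (Mul t u) (Mul t' u') \<in> D"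
    "Less t u \<in> D \<longleftrightarrow> Less t' u' \<in> D"
proof -
  have "Eq (f t u) (f t' u) \<in> D \<and> Eq (f t' u) (f t' u') \<in> D" if "f = Add \<or> f = Mul" for f
    using that assms henkin_eq_refl
      henkin_Leibniz[of t t' "Eq (lift_tm (f t u)) (f (Var 0) (lift_tm u))"]
      henkin_Leibniz[of u u' "Eq (lift_tm (f t' u)) (f (lift_tm t') (Var 0))"]
    by (auto simp: inst_def)
  then show "Eq (Add t u) (Add t' u') \<in> D" "Eq (Mul t u) (Mul t' u') \<in> D"
    using henkin_eq_trans by blast+
  have "Less t u \<in> D \<Longrightarrow> Less t' u' \<in> D"
    if "Eq t t' \<in> D" "Eq u u' \<in> D" for t t' u u'
    using that henkin_Leibniz[of t t' "Less (Var 0) (lift_tm u)"]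
      henkin_Leibniz[of u u' "Less (lift_tm t') (Var 0)"]
    by (auto simp: inst_def)
  then show "Less t u \<in> D \<longleftrightarrow> Less t' u' \<in> D" using assms henkin_eq_sym by blast
qed

end

text \<open>A type cannot depend on a formula fixed in a proof, so the model is a single global type:
  it is a counterexample to the theorem if there is one, and otherwise an arbitrary model of
  \<^const>\<open>Pminus\<close>.\<close>

definition unprovable :: fm where
  "unprovable = (SOME p. p \<in> BME_star \<and> \<not> PSigma1 \<turnstile> p)"

definition model_theory :: "fm set" where
  "model_theory =
     (if \<exists>p \<in> BME_star. \<not> PSigma1 \<turnstile> p then insert (Neg unprovable) PSigma1 else Pminus)"

lemma Pminus_subset_PSigma1: "Pminus \<subseteq> PSigma1"
  by (auto simp: PSigma1_def ISigma1_def)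

lemma Pminus_subset_model_theory: "Pminus \<subseteq> model_theory"
  using Pminus_subset_PSigma1 by (auto simp: model_theory_def)

lemma unprovable:
  assumes "\<exists>p \<in> BME_star. \<not> PSigma1 \<turnstile> p"
  shows "unprovable \<in> BME_star" "\<not> PSigma1 \<turnstile> unprovable"
  using someI_ex[of "\<lambda>p. p \<in> BME_star \<and> \<not> PSigma1 \<turnstile> p"] assms by (auto simp: unprovable_def)

lemma bound_PSigma1: "p \<in> PSigma1 \<Longrightarrow> bound p = 0"
  by (auto simp: PSigma1_def ISigma1_def Pminus_def Induction_def IterationP_def)

lemma bound_BME_star: "p \<in> BME_star \<Longrightarrow> bound p = 0"
  by (auto simp: BME_star_def BME_def)

lemma bound_model_theory: "p \<in> model_theory \<Longrightarrow> bound p = 0"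
  using unprovable(1) bound_PSigma1 bound_BME_star Pminus_subset_PSigma1
  by (auto simp: model_theory_def Neg_def split: if_splits)

text \<open>With a counterexample, inconsistency would make it provable after all, by contradiction;
  without one the natural numbers are a model.\<close>

lemma model_theory_consistent: "\<not> model_theory \<turnstile> Bot"
proof (cases "\<exists>p \<in> BME_star. \<not> PSigma1 \<turnstile> p")
  case True
  show ?thesis
  proof
    assume "model_theory \<turnstile> Bot"
    then have "entails PSigma1 {Neg unprovable} Bot"
      using True bound_model_theory[of "Neg unprovable"]
      by (auto simp: model_theory_def intro: proves_insert)
    then have "PSigma1 \<turnstile> unprovable" by (simp add: entails_contr entails_empty)
    then show False using unprovable(2) True by blast
  qed
next
  case False
  have "\<forall>p \<in> Pminus. \<forall>e :: nat \<Rightarrow> nat. sem e p"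
    unfolding Pminus_valid_iff by (auto simp: algebra_simps dest: less_imp_add_positive)
  then show ?thesis
    using False soundness[of Pminus Bot "\<lambda>_. 0 :: nat"] by (auto simp: model_theory_def)
qed

definition model_set :: "fm set" where
  "model_set = (SOME D. henkin model_theory D)"

lemma henkin_model_set: "henkin model_theory model_set"
  unfolding model_set_def
  using henkin_exists[OF bound_model_theory model_theory_consistent] by (metis someI)

\<comment> \<open>All terms are taken, open ones included, since their variables are the Henkin
  constants.\<close>
quotient_type model = tm / "\<lambda>t u. Eq t u \<in> model_set"
  by (rule henkin_eq_equivp[OF henkin_model_set])

instantiation model :: "{zero,one,plus,times,ord}"
begin

lift_definition zero_model :: model is Zero .

lift_definition one_model :: model is One .

lift_definition plus_model :: "model \<Rightarrow> model \<Rightarrow> model" is Add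
  by (rule henkin_eq_cong[OF henkin_model_set])

lift_definition times_model :: "model \<Rightarrow> model \<Rightarrow> model" is Mul
  by (rule henkin_eq_cong[OF henkin_model_set])

lift_definition less_model :: "model \<Rightarrow> model \<Rightarrow> bool" is "\<lambda>t u. Less t u \<in> model_set"
  by (rule henkin_eq_cong[OF henkin_model_set])

definition less_eq_model :: "model \<Rightarrow> model \<Rightarrow> bool" where
  "x \<le> y \<longleftrightarrow> x < y \<or> x = (y :: model)"

instance ..

end

lemma sem_tm_model: "sem_tm (\<lambda>k. abs_model (f k)) t = abs_model (subst_tm f t)"
  by (induction t)
    (simp_all add: zero_model_def one_model_def plus_model.abs_eq times_model.abs_eq)

lemma abs_model_surj: "\<exists>t. x = abs_model t"
  by (metis Quotient3_abs_rep Quotient3_model)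

text \<open>The truth lemma. In the quantifier case every element of the model is the class of a
  term, so ranging over elements amounts to ranging over the instances in the \<open>All\<close>
  clause of \<open>henkin\<close>.\<close>

lemma sem_model: "sem (\<lambda>k. abs_model (f k)) p \<longleftrightarrow> subst f p \<in> model_set"
proof (induction p arbitrary: f)
  case Bot
  then show ?case by (simp add: henkin_Bot[OF henkin_model_set])
next
  case (Eq t u)
  then show ?case by (simp add: sem_tm_model model.abs_eq_iff)
next
  case (Less t u)
  then show ?case by (simp add: sem_tm_model less_model.abs_eq)
next
  case (Imp p q)
  then show ?case by (simp add: henkin_Imp[OF henkin_model_set])
next
  case (All p)
  have "abs_model t ## (\<lambda>k. abs_model (f k)) = (\<lambda>k. abs_model ((t ## f) k))" for t
    by (rule ext) (simp split: nat.split)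
  then have "sem (abs_model t ## (\<lambda>k. abs_model (f k))) p \<longleftrightarrow> subst (t ## f) p \<in> model_set" for t
    by (simp add: All.IH)
  then have "sem (\<lambda>k. abs_model (f k)) (All p) \<longleftrightarrow> (\<forall>t. subst (t ## f) p \<in> model_set)"
    using abs_model_surj by (metis sem.simps(5))
  then show ?case
    using henkin_All[OF henkin_model_set, of "subst (up f) p"] by (simp add: inst_subst_up)
qed

lemma model_valid:
  assumes "p \<in> model_theory"
  shows "sem (e :: nat \<Rightarrow> model) p"
proof -
  obtain f where "\<And>k. e k = abs_model (f k)"
    using choice[of "\<lambda>k t. e k = abs_model t"] abs_model_surj by blast
  then have "e = (\<lambda>k. abs_model (f k))" by blast
  then show ?thesis
    using assms henkin_proves[OF henkin_model_set proves.Ax]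
    by (simp add: sem_model subst_sentence bound_model_theory)
qed

lemma Pminus_valid_model: "\<forall>p \<in> Pminus. \<forall>e :: nat \<Rightarrow> model. sem e p"
  by (intro ballI allI model_valid subsetD[OF Pminus_subset_model_theory])

lemma Pminus_model [rule_format]:
  "\<forall>x y z :: model. (x + y) + z = x + (y + z)" "\<forall>x y :: model. x + y = y + x"
  "\<forall>x y z :: model. (x * y) * z = x * (y * z)" "\<forall>x y :: model. x * y = y * x"
  "\<forall>x y z :: model. x * (y + z) = x * y + x * z"
  "\<forall>x :: model. x + 0 = x" "\<forall>x :: model. x * 0 = 0" "\<forall>x :: model. x * 1 = x"
  "\<forall>x y z :: model. x < y \<and> y < z \<longrightarrow> x < z" "\<forall>x :: model. \<not> x < x"
  "\<forall>x y :: model. x < y \<or> x = y \<or> y < x"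
  "\<forall>x y z :: model. x < y \<longrightarrow> x + z < y + z"
  "\<forall>x y z :: model. 0 < z \<and> x < y \<longrightarrow> x * z < y * z"
  "\<forall>x y :: model. x < y \<longrightarrow> (\<exists>z. x + z = y)" "(0 :: model) < 1"
  "\<forall>x :: model. 0 < x \<longrightarrow> 1 < x \<or> 1 = x" "\<forall>x :: model. 0 < x \<or> 0 = x"
  by (insert iffD1[OF Pminus_valid_iff Pminus_valid_model])
    (elim conjE, assumption)+

instance model :: linorder
proof
  fix x y z :: model
  note P = Pminus_model(9)[of x y z] Pminus_model(9)[of x y x] Pminus_model(10)[of x] Pminus_model(11)[of x y]
  show "x < y \<longleftrightarrow> x \<le> y \<and> \<not> y \<le> x" "x \<le> x" "x \<le> y \<Longrightarrow> y \<le> z \<Longrightarrow> x \<le> z"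
    "x \<le> y \<Longrightarrow> y \<le> x \<Longrightarrow> x = y" "x \<le> y \<or> y \<le> x"
    using P by (auto simp: less_eq_model_def)
qed

section \<open>Truncated subtraction and the ordered semiring\<close>

instantiation model :: minus
begin

text \<open>The class \<open>linordered_semidom\<close> demands a subtraction, which is not among
  the symbols of arithmetic. A difference is unique by cancellation; where none exists the value is
  0, as the law \<open>a - b - c = a - (b + c)\<close> requires.\<close>

definition minus_model :: "model \<Rightarrow> model \<Rightarrow> model" where
  "x - y = (if y \<le> (x :: model) then THE z. y + z = x else 0)"

instance ..

end

lemma model_add_cancel: "(x :: model) + y = x + z \<longleftrightarrow> y = z"
  using Pminus_model(2,10,11,12) by metis

lemma model_le_add: "(x :: model) \<le> x + y"
  using Pminus_model(2)[of x] Pminus_model(6)[of x] Pminus_model(12)[of 0 y x] Pminus_model(17)[of y]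
  by (metis less_eq_model_def)

lemma model_le_iff: "(x :: model) \<le> y \<longleftrightarrow> (\<exists>z. y = x + z)"
  using model_le_add Pminus_model(14)[of x y] Pminus_model(6)[of x]
  by (metis less_eq_model_def)

lemma model_minus_eq: "y + z = x \<Longrightarrow> x - y = (z :: model)"
proof -
  assume *: "y + z = x"
  then have "y \<le> x" using model_le_add by blast
  moreover have "(THE z. y + z = x) = z" using * by (intro the_equality) (auto simp: model_add_cancel)
  ultimately show ?thesis by (simp add: minus_model_def)
qed

lemma model_minus_zero: "x \<le> y \<Longrightarrow> x - y = (0 :: model)"
  using model_minus_eq[of x 0 x] Pminus_model(6) by (auto simp: minus_model_def)

instance model :: linordered_semidom
proof
  fix a b c :: model
  note P = Pminus_model
  show "a * b * c = a * (b * c)" "a * b = b * a" "1 * a = a" "a + b + c = a + (b + c)"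
    "a + b = b + a" "0 + a = a" "(a + b) * c = a * c + b * c" "0 * a = 0" "a * 0 = 0"
    "a * (b + c) = a * b + a * c"
    using P by metis+
  show "a + b - a = b" by (simp add: model_minus_eq)
  show "a - b - c = a - (b + c)"
  proof (cases "b + c \<le> a")
    case True
    then obtain d where "a = b + (c + d)" using P(1) by (auto simp: model_le_iff)
    moreover from this have "a - b = c + d" "a = (b + c) + d" by (simp_all add: model_minus_eq P(1))
    ultimately show ?thesis by (simp add: model_minus_eq)
  next
    case False
    then have r: "a - (b + c) = 0" by (simp add: minus_model_def)
    show ?thesis
    proof (cases "b \<le> a")
      case True
      then obtain d where d: "a = b + d" by (auto simp: model_le_iff)
      then have "\<not> c \<le> d" using False P(1) by (auto simp: model_le_iff)
      then show ?thesis using d r by (simp add: model_minus_eq model_minus_zero)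
    next
      case False
      then have "a - b = 0" by (simp add: minus_model_def)
      moreover have "0 - c = 0"
        using model_minus_zero[of 0 c] P(17)[of c] by (auto simp: less_eq_model_def)
      ultimately show ?thesis using r by simp
    qed
  qed
  show "(0 :: model) \<noteq> 1" "(0 :: model) < 1" using P(10,15) by metis+
  show "a * (b - c) = a * b - a * c"
  proof (cases "c \<le> b")
    case True
    then obtain d where "b = c + d" by (auto simp: model_le_iff)
    then show ?thesis by (simp add: model_minus_eq P(5))
  next
    case False
    then have "b \<le> c" by simp
    moreover from this have "a * b \<le> a * c" using P(5) by (auto simp: model_le_iff)
    ultimately show ?thesis by (simp add: model_minus_zero P(7))
  qed
  show "a \<le> b \<Longrightarrow> c + a \<le> c + b" using P(1) by (auto simp: model_le_iff)
  show "a < b \<Longrightarrow> 0 < c \<Longrightarrow> c * a < c * b" using P(4,13) by metis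
  show "a \<noteq> 0 \<Longrightarrow> b \<noteq> 0 \<Longrightarrow> a * b \<noteq> 0"
    using P(4,7,10,13,17) by metis
  show "b \<le> a \<Longrightarrow> a - b + b = a" 
    by (auto simp: model_le_iff model_minus_eq P(2)[of _ b])
qed

section \<open>Definability with parameters\<close>

primrec ev :: "(nat \<Rightarrow> 'a) \<Rightarrow> nat + 'a \<Rightarrow> 'a" where
  "ev e (Inl k) = e k"
| "ev e (Inr c) = c"

text \<open>The function \<open>r\<close> tells which variables stand for arguments and which for parameters.\<close>

definition tfun :: "((nat \<Rightarrow> 'a::{zero,one,plus,times,ord}) \<Rightarrow> 'a) \<Rightarrow> bool" where
  "tfun f \<longleftrightarrow> (\<exists>t r. \<forall>e. f e = sem_tm (\<lambda>k. ev e (r k)) t)"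

definition definable :: "(fm \<Rightarrow> bool) \<Rightarrow> ((nat \<Rightarrow> 'a::{zero,one,plus,times,ord}) \<Rightarrow> bool) \<Rightarrow> bool" where
  "definable C P \<longleftrightarrow> (\<exists>p r. C p \<and> (\<forall>e. P e \<longleftrightarrow> sem (\<lambda>k. ev e (r k)) p))"

abbreviation "delta \<equiv> definable Delta0"
abbreviation "sigma \<equiv> definable Sigma1"

lemma Delta0_subst: "Delta0 p \<Longrightarrow> Delta0 (subst f p)"
proof (induction arbitrary: f rule: Delta0.induct)
  case (5 p t)
  have "subst_tm (up f) (lift_tm t) = lift_tm (subst_tm f t)"
    by (simp add: subst_tm_lift_tm lift_tm_subst_tm)
  then show ?case using 5 by (simp add: Delta0.intros)
qed (auto intro: Delta0.intros)

lemma Sigma1_subst: "Sigma1 p \<Longrightarrow> Sigma1 (subst f p)"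
proof (induction arbitrary: f rule: Sigma1.induct)
  case (2 p)
  then show ?case using Sigma1.intros(2)[of "subst (up f) p"] by (simp add: Ex_def Neg_def)
qed (simp add: Delta0_subst Sigma1.intros)

lemma definable_mono: "definable C P \<Longrightarrow> (\<And>p. C p \<Longrightarrow> C' p) \<Longrightarrow> definable C' P"
  unfolding definable_def by blast

lemma sigma_delta: "delta P \<Longrightarrow> sigma P"
  by (rule definable_mono[of Delta0]) (auto intro: Sigma1.intros)

text \<open>Interleaves two assignments on even and odd variables, so two formulas can be evaluated
  under a common one without a clash of variables.\<close>

definition merge :: "(nat \<Rightarrow> 'b) \<Rightarrow> (nat \<Rightarrow> 'b) \<Rightarrow> nat \<Rightarrow> 'b" where
  "merge r r' k = (if even k then r (k div 2) else r' (k div 2))"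

lemma merge_simps [simp]: "merge r r' (2 * k) = r k" "merge r r' (Suc (2 * k)) = r' k"
  by (simp_all add: merge_def)

lemma definable_pair:
  assumes "definable C P" "definable C Q" and C: "\<And>p f. C p \<Longrightarrow> C (subst f p)"
  obtains p q r where "C p" "C q" "\<And>e. P e \<longleftrightarrow> sem (\<lambda>k. ev e (r k)) p"
    "\<And>e. Q e \<longleftrightarrow> sem (\<lambda>k. ev e (r k)) q"
proof -
  obtain p r where p: "C p" "\<And>e. P e \<longleftrightarrow> sem (\<lambda>k. ev e (r k)) p"
    using assms(1) by (auto simp: definable_def)
  obtain q r' where q: "C q" "\<And>e. Q e \<longleftrightarrow> sem (\<lambda>k. ev e (r' k)) q"
    using assms(2) by (auto simp: definable_def)
  show thesis
    by (rule that[of "subst (\<lambda>k. Var (2 * k)) p" "subst (\<lambda>k. Var (Suc (2 * k))) q" "merge r r'"])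
      (simp_all add: C p q sem_subst)
qed

lemma tfun_pair:
  assumes "tfun f" "tfun g"
  obtains t u r where "\<And>e. f e = sem_tm (\<lambda>k. ev e (r k)) t" "\<And>e. g e = sem_tm (\<lambda>k. ev e (r k)) u"
proof -
  obtain t r where t: "\<And>e. f e = sem_tm (\<lambda>k. ev e (r k)) t"
    using assms(1) by (auto simp: tfun_def)
  obtain u r' where u: "\<And>e. g e = sem_tm (\<lambda>k. ev e (r' k)) u"
    using assms(2) by (auto simp: tfun_def)
  show thesis
    by (rule that[of "merge r r'" "subst_tm (\<lambda>k. Var (2 * k)) t" "subst_tm (\<lambda>k. Var (Suc (2 * k))) u"])
      (simp_all add: t u sem_subst_tm)
qed

lemma tfun_var [intro!]: "tfun (\<lambda>e. e n)"
  unfolding tfun_def by (intro exI[of _ "Var 0"] exI[of _ "\<lambda>_. Inl n"]) simp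

lemma tfun_const [intro!]: "tfun (\<lambda>e. c)"
  unfolding tfun_def by (intro exI[of _ "Var 0"] exI[of _ "\<lambda>_. Inr c"]) simp

lemma tfun_add [intro!]: "tfun f \<Longrightarrow> tfun g \<Longrightarrow> tfun (\<lambda>e. f e + g e)"
  by (erule tfun_pair, assumption, unfold tfun_def) (metis sem_tm.simps(4))

lemma tfun_mult [intro!]: "tfun f \<Longrightarrow> tfun g \<Longrightarrow> tfun (\<lambda>e. f e * g e)"
  by (erule tfun_pair, assumption, unfold tfun_def) (metis sem_tm.simps(5))

lemma tfun_shift: "tfun f \<Longrightarrow> tfun (\<lambda>e. f (\<lambda>k. e (Suc k)))"
proof -
  assume "tfun f"
  then obtain t r where t: "\<And>e. f e = sem_tm (\<lambda>k. ev e (r k)) t" by (auto simp: tfun_def)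
  have "ev (\<lambda>k. e (Suc k)) s = ev e (map_sum Suc id s)" for e :: "nat \<Rightarrow> 'a" and s
    by (cases s) simp_all
  then show ?thesis
    unfolding tfun_def t by (intro exI[of _ t] exI[of _ "\<lambda>k. map_sum Suc id (r k)"]) simp
qed

text \<open>Every free variable is replaced by the term that defines its component, after the
  variables of these terms have been made disjoint.\<close>

lemma definable_comp:
  assumes "definable C P" "\<And>k. tfun (g k)" and C: "\<And>p f. C p \<Longrightarrow> C (subst f p)"
  shows "definable C (\<lambda>e. P (\<lambda>k. g k e))"
proof -
  obtain p r where p: "C p" "\<And>e. P e \<longleftrightarrow> sem (\<lambda>k. ev e (r k)) p"
    using assms(1) by (auto simp: definable_def)
  have "\<exists>t s. \<forall>e. g k e = sem_tm (\<lambda>j. ev e (s j)) t" for k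
    using assms(2) by (auto simp: tfun_def)
  then obtain t s where t: "\<And>k e. g k e = sem_tm (\<lambda>j. ev e (s k j)) (t k)" by metis
  \<comment> \<open>Tag 0 is reserved for the parameters of \<open>p\<close>; tag
    \<open>Suc i\<close> marks the variables of the term for component \<open>i\<close>.\<close>
  define f where "f k = (case r k of Inl i \<Rightarrow> subst_tm (\<lambda>j. Var (prod_encode (Suc i, j))) (t i)
    | Inr c \<Rightarrow> Var (prod_encode (0, k)))" for k
  define r' where "r' k = (case prod_decode k of (0, j) \<Rightarrow> r j | (Suc i, j) \<Rightarrow> s i j)" for k
  have "ev (\<lambda>k. g k e) (r k) = sem_tm (\<lambda>k. ev e (r' k)) (f k)" for k e
    by (cases "r k") (simp_all add: f_def r'_def sem_subst_tm t)
  then have "P (\<lambda>k. g k e) \<longleftrightarrow> sem (\<lambda>k. ev e (r' k)) (subst f p)" for e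
    by (simp add: p(2) sem_subst)
  then show ?thesis using C[OF p(1)] unfolding definable_def by blast
qed

lemmas delta_comp = definable_comp[where C = Delta0, OF _ _ Delta0_subst]
lemma definable_comp1:
  assumes "definable C (\<lambda>e. P (e 0))" "tfun f" and C: "\<And>p f. C p \<Longrightarrow> C (subst f p)"
  shows "definable C (\<lambda>e. P (f e))"
  using definable_comp[OF assms(1) _ C, of "\<lambda>_. f"] assms by simp

lemma definable_comp2:
  assumes "definable C (\<lambda>e. P (e 0) (e (Suc 0)))" "tfun f" "tfun g"
    and C: "\<And>p f. C p \<Longrightarrow> C (subst f p)"
  shows "definable C (\<lambda>e. P (f e) (g e))"
  using definable_comp[OF assms(1) _ C, of "f ## (\<lambda>_. g)"] assms by (simp split: nat.split)

lemma definable_comp3: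
  assumes "definable C (\<lambda>e. P (e 0) (e (Suc 0)) (e (Suc (Suc 0))))" "tfun f" "tfun g" "tfun h"
    and C: "\<And>p f. C p \<Longrightarrow> C (subst f p)"
  shows "definable C (\<lambda>e. P (f e) (g e) (h e))"
  using definable_comp[OF assms(1) _ C, of "f ## g ## (\<lambda>_. h)"] assms by (simp split: nat.split)

section \<open>Closure of bounded and of Sigma_1 predicates\<close>

lemma delta_const [intro!]: "delta (\<lambda>e. b)"
proof -
  have "Delta0 (if b then Imp Bot Bot else Bot)" by (simp add: Delta0.intros)
  then show ?thesis
    unfolding definable_def by (intro exI[of _ "if b then Imp Bot Bot else Bot"]) auto
qed

lemma delta_eq [intro!]: "tfun f \<Longrightarrow> tfun g \<Longrightarrow> delta (\<lambda>e. f e = g e)"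
  by (erule tfun_pair, assumption, unfold definable_def) (metis Delta0.intros(2) sem.simps(2))

lemma delta_less [intro!]: "tfun f \<Longrightarrow> tfun g \<Longrightarrow> delta (\<lambda>e. f e < g e)"
  by (erule tfun_pair, assumption, unfold definable_def) (metis Delta0.intros(3) sem.simps(3))

lemma delta_imp [intro!]: "delta P \<Longrightarrow> delta Q \<Longrightarrow> delta (\<lambda>e. P e \<longrightarrow> Q e)"
  by (erule definable_pair, assumption, erule Delta0_subst, unfold definable_def)
    (metis Delta0.intros(4) sem.simps(4))

lemma delta_not [intro!]: "delta P \<Longrightarrow> delta (\<lambda>e. \<not> P e)"
  using delta_imp[of P "\<lambda>_. False"] delta_const[of False] by simp

lemma delta_conj [intro!]: "delta P \<Longrightarrow> delta Q \<Longrightarrow> delta (\<lambda>e. P e \<and> Q e)"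
  using delta_not[OF delta_imp[OF _ delta_not], of P Q] by simp

lemma delta_disj [intro!]: "delta P \<Longrightarrow> delta Q \<Longrightarrow> delta (\<lambda>e. P e \<or> Q e)"
  using delta_imp[OF delta_not, of P Q] by (simp add: imp_conv_disj)

lemma delta_le [intro!]:
  fixes f g :: "(nat \<Rightarrow> 'a::{zero,one,plus,times,linorder}) \<Rightarrow> 'a"
  shows "tfun f \<Longrightarrow> tfun g \<Longrightarrow> delta (\<lambda>e. f e \<le> g e)"
  using delta_not[OF delta_less, of g f] by (simp add: not_less)

lemma delta_ball [intro!]:
  assumes "delta (\<lambda>e. R (\<lambda>k. e (Suc k)) (e 0))" "tfun f"
  shows "delta (\<lambda>e. \<forall>x. x < f e \<longrightarrow> R e x)"
proof -
  obtain p r where p: "Delta0 p" "\<And>e. R (\<lambda>k. e (Suc k)) (e 0) \<longleftrightarrow> sem (\<lambda>k. ev e (r k)) p"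
    using assms(1) by (auto simp: definable_def)
  \<comment> \<open>Several variables of \<open>p\<close> may stand for argument 0; all are
    identified with the bound variable, and the others are moved past it and past the variable that
    holds the bound.\<close>
  define g where "g k = (if r k = Inl 0 then Var 0 else Var (Suc (Suc k)))" for k
  define r' where "r' = Inl 0 ## r"
  have "sem_tm (x ## (\<lambda>k. ev e (r' k))) (g k) = ev (x ## (\<lambda>k. e (Suc k))) (r k)" for e x k
    by (cases "r k") (auto simp: g_def r'_def split: nat.split)
  then have "sem (x ## (\<lambda>k. ev e (r' k))) (subst g p) \<longleftrightarrow> R (\<lambda>k. e (Suc k)) x" for e x
    using p(2)[of "x ## (\<lambda>k. e (Suc k))"] by (simp add: sem_subst)
  then have "(\<forall>x. x < e 0 \<longrightarrow> R (\<lambda>k. e (Suc k)) x) \<longleftrightarrow>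
      sem (\<lambda>k. ev e (r' k)) (All (Imp (Less (Var 0) (lift_tm (Var 0))) (subst g p)))" for e
    by (simp add: r'_def)
  moreover have "Delta0 (All (Imp (Less (Var 0) (lift_tm (Var 0))) (subst g p)))"
    using p(1) by (intro Delta0.intros Delta0_subst)
  ultimately have "delta (\<lambda>e. \<forall>x. x < e 0 \<longrightarrow> R (\<lambda>k. e (Suc k)) x)"
    unfolding definable_def by blast
  \<comment> \<open>\<open>Delta0\<close> requires a bound free of the quantified variable, so
    argument 0 served as the bound so far; only now is \<open>f\<close> substituted for it.\<close>
  from delta_comp[OF this, of "f ## (\<lambda>k e. e k)"] assms(2)
  show ?thesis by (simp add: tfun_var split: nat.split)
qed

lemma delta_bex [intro!]:
  assumes "delta (\<lambda>e. R (\<lambda>k. e (Suc k)) (e 0))" "tfun f"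
  shows "delta (\<lambda>e. \<exists>x. x < f e \<and> R e x)"
  using delta_not[OF delta_ball[OF delta_not[OF assms(1)] assms(2)]] by simp

lemma sigma_ex [intro!]:
  assumes "sigma (\<lambda>e. R (\<lambda>k. e (Suc k)) (e 0))"
  shows "sigma (\<lambda>e. \<exists>x. R e x)"
proof -
  obtain p r where p: "Sigma1 p" "\<And>e. R (\<lambda>k. e (Suc k)) (e 0) \<longleftrightarrow> sem (\<lambda>k. ev e (r k)) p"
    using assms(1) by (auto simp: definable_def)
  define g where "g k = (if r k = Inl 0 then Var 0 else Var (Suc k))" for k
  define r' where "r' k = (case r k of Inl (Suc j) \<Rightarrow> Inl j | Inl 0 \<Rightarrow> Inl 0 | Inr c \<Rightarrow> Inr c)" for k
  have "sem_tm (x ## (\<lambda>k. ev e (r' k))) (g k) = ev (x ## e) (r k)" for e x k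
    by (cases "r k") (auto simp: g_def r'_def split: nat.split)
  then have "sem (x ## (\<lambda>k. ev e (r' k))) (subst g p) \<longleftrightarrow> R e x" for e x
    using p(2)[of "x ## e"] by (simp add: sem_subst)
  then have "(\<exists>x. R e x) \<longleftrightarrow> sem (\<lambda>k. ev e (r' k)) (Ex (subst g p))" for e
    by simp
  moreover have "Sigma1 (Ex (subst g p))"
    using p(1) by (intro Sigma1.intros(2) Sigma1_subst)
  ultimately show ?thesis unfolding definable_def by blast
qed

text \<open>Prenex form with a single existential quantifier: nested witnesses are bounded by their
  maximum.\<close>

lemma Sigma1_prenex:
  fixes r :: "nat \<Rightarrow> nat + 'a::linordered_semidom"
  assumes "Sigma1 p"
  shows "\<exists>Q. delta (\<lambda>e. Q (\<lambda>k. e (Suc k)) (e 0)) \<and>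
    (\<forall>e. sem (\<lambda>k. ev e (r k)) p \<longleftrightarrow> (\<exists>x. Q e x))"
  using assms
proof (induction arbitrary: r rule: Sigma1.induct)
  case (1 p)
  then have "delta (\<lambda>e :: nat \<Rightarrow> 'a. sem (\<lambda>k. ev e (r k)) p)" unfolding definable_def by blast
  from delta_comp[OF this, of "\<lambda>k e. e (Suc k)"]
  have "delta (\<lambda>e :: nat \<Rightarrow> 'a. sem (\<lambda>k. ev (\<lambda>k. e (Suc k)) (r k)) p)" by (simp add: tfun_var)
  then show ?case by (intro exI[of _ "\<lambda>e _. sem (\<lambda>k. ev e (r k)) p"]) simp
next
  case (2 p)
  define r' where "r' = Inl 0 ## (\<lambda>k. map_sum Suc id (r k))"
  obtain Q :: "(nat \<Rightarrow> 'a) \<Rightarrow> 'a \<Rightarrow> bool" where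
    Q: "delta (\<lambda>e. Q (\<lambda>k. e (Suc k)) (e 0))" "\<And>e. sem (\<lambda>k. ev e (r' k)) p \<longleftrightarrow> (\<exists>x. Q e x)"
    using "2.IH"[of r'] by blast
  have "ev (y ## e) (map_sum Suc id s) = ev e s" for y e and s :: "nat + 'a"
    by (cases s) simp_all
  then have "ev (y ## e) (r' k) = (y ## (\<lambda>k. ev e (r k))) k" for y e k
    by (cases k) (simp_all add: r'_def)
  then have "sem (\<lambda>k. ev e (r k)) (Ex p) \<longleftrightarrow> (\<exists>y x. Q (y ## e) x)" for e
    using Q(2)[of "_ ## e"] by simp
  moreover have "(\<exists>y x. Q (y ## e) x) \<longleftrightarrow> (\<exists>w. \<exists>y<w. \<exists>x<w. Q (y ## e) x)" for e
  proof
    assume "\<exists>y x. Q (y ## e) x"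
    then obtain y x where "Q (y ## e) x" by blast
    moreover have "y < max y x + 1" "x < max y x + 1"
      by (auto intro: le_less_trans[OF _ less_add_one])
    ultimately show "\<exists>w. \<exists>y<w. \<exists>x<w. Q (y ## e) x" by blast
  qed blast
  moreover have "((\<lambda>e. e (Suc 0)) ## (\<lambda>k e. e (Suc (Suc (Suc k))))) k e =
      (e (Suc 0) ## (\<lambda>k. e (Suc (Suc (Suc k))))) k" for k and e :: "nat \<Rightarrow> 'a"
    by (cases k) simp_all
  then have "delta (\<lambda>e. Q (e (Suc 0) ## (\<lambda>k. e (Suc (Suc (Suc k))))) (e 0))"
    using delta_comp[OF Q(1), of "(\<lambda>e. e 0) ## (\<lambda>e. e (Suc 0)) ## (\<lambda>k e. e (Suc (Suc (Suc k))))"]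
    by (simp add: tfun_var split: nat.split)
  then have "delta (\<lambda>e. \<exists>y<e 0. \<exists>x<e 0. Q (y ## (\<lambda>k. e (Suc k))) x)"
    by (intro delta_bex tfun_var)
  ultimately show ?case
    by (intro exI[of _ "\<lambda>e w. \<exists>y<w. \<exists>x<w. Q (y ## e) x"]) simp
qed

lemma sigma_prenex:
  fixes P :: "(nat \<Rightarrow> 'a::linordered_semidom) \<Rightarrow> bool"
  assumes "sigma P"
  obtains Q where "delta (\<lambda>e. Q (\<lambda>k. e (Suc k)) (e 0))" "\<And>e. P e \<longleftrightarrow> (\<exists>x. Q e x)"
proof -
  obtain p r where p: "Sigma1 p" "\<And>e. P e \<longleftrightarrow> sem (\<lambda>k. ev e (r k)) p"
    using assms by (auto simp: definable_def)
  show thesis using Sigma1_prenex[OF p(1), of r] that p(2) by blast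
qed

lemma sigma_eq [intro!]: "tfun f \<Longrightarrow> tfun g \<Longrightarrow> sigma (\<lambda>e. f e = g e)"
  by (intro sigma_delta delta_eq)

lemma sigma_less [intro!]: "tfun f \<Longrightarrow> tfun g \<Longrightarrow> sigma (\<lambda>e. f e < g e)"
  by (intro sigma_delta delta_less)

lemma sigma_le [intro!]:
  fixes f g :: "(nat \<Rightarrow> 'a::{zero,one,plus,times,linorder}) \<Rightarrow> 'a"
  shows "tfun f \<Longrightarrow> tfun g \<Longrightarrow> sigma (\<lambda>e. f e \<le> g e)"
  by (intro sigma_delta delta_le)

lemma sigma_not [intro!]: "delta P \<Longrightarrow> sigma (\<lambda>e. \<not> P e)"
  by (intro sigma_delta delta_not)

lemma delta_shift: "delta P \<Longrightarrow> delta (\<lambda>e. P (\<lambda>k. e (Suc k)))"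
  using delta_comp[of P "\<lambda>k e. e (Suc k)"] by (simp add: tfun_var)

lemma delta_skip:
  "delta (\<lambda>e. Q (\<lambda>k. e (Suc k)) (e 0)) \<Longrightarrow> delta (\<lambda>e. Q (\<lambda>k. e (Suc (Suc k))) (e 0))"
  using delta_comp[of "\<lambda>e. Q (\<lambda>k. e (Suc k)) (e 0)" "(\<lambda>e. e 0) ## (\<lambda>k e. e (Suc (Suc k)))"]
  by (simp add: tfun_var split: nat.split)

text \<open>\<open>Sigma1\<close> formulas are literal blocks of existential quantifiers, so the
  conjunction is formed inside the prenex forms, with the two witnesses kept apart.\<close>

lemma sigma_conj [intro!]:
  fixes P Q :: "(nat \<Rightarrow> 'a::linordered_semidom) \<Rightarrow> bool"
  assumes "sigma P" "sigma Q"
  shows "sigma (\<lambda>e. P e \<and> Q e)"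
proof -
  obtain P' where P: "delta (\<lambda>e. P' (\<lambda>k. e (Suc k)) (e 0))" "\<And>e. P e \<longleftrightarrow> (\<exists>x. P' e x)"
    using sigma_prenex[OF assms(1)] by blast
  obtain Q' where Q: "delta (\<lambda>e. Q' (\<lambda>k. e (Suc k)) (e 0))" "\<And>e. Q e \<longleftrightarrow> (\<exists>x. Q' e x)"
    using sigma_prenex[OF assms(2)] by blast
  have "sigma (\<lambda>e. \<exists>x y. P' e x \<and> Q' e y)"
    using delta_shift[OF P(1)] delta_skip[OF Q(1)] by (intro sigma_ex sigma_delta delta_conj)
  then show ?thesis by (simp add: P Q)
qed

lemma sigma_disj [intro!]:
  fixes P Q :: "(nat \<Rightarrow> 'a::linordered_semidom) \<Rightarrow> bool"
  assumes "sigma P" "sigma Q"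
  shows "sigma (\<lambda>e. P e \<or> Q e)"
proof -
  obtain P' where P: "delta (\<lambda>e. P' (\<lambda>k. e (Suc k)) (e 0))" "\<And>e. P e \<longleftrightarrow> (\<exists>x. P' e x)"
    using sigma_prenex[OF assms(1)] by blast
  obtain Q' where Q: "delta (\<lambda>e. Q' (\<lambda>k. e (Suc k)) (e 0))" "\<And>e. Q e \<longleftrightarrow> (\<exists>x. Q' e x)"
    using sigma_prenex[OF assms(2)] by blast
  have "sigma (\<lambda>e. \<exists>x. P' e x \<or> Q' e x)"
    using P(1) Q(1) by (intro sigma_ex sigma_delta delta_disj)
  then show ?thesis by (simp add: P Q ex_disj_distrib)
qed

lemma sigma_imp [intro!]:
  fixes P Q :: "(nat \<Rightarrow> 'a::linordered_semidom) \<Rightarrow> bool"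
  shows "delta P \<Longrightarrow> sigma Q \<Longrightarrow> sigma (\<lambda>e. P e \<longrightarrow> Q e)"
  using sigma_disj[OF sigma_not, of P Q] by simp

text \<open>Back from predicates to formulas: the parameters move to the variables from \<open>n\<close> on.\<close>

lemma definable_formula:
  fixes P :: "(nat \<Rightarrow> 'a::{zero,one,plus,times,ord}) \<Rightarrow> bool"
  assumes "definable C P" and C: "\<And>p f. C p \<Longrightarrow> C (subst f p)"
  shows "\<exists>p e'. C p \<and> (\<forall>x. P (\<lambda>k. if k < n then x k else 0) \<longleftrightarrow>
    sem (\<lambda>k. if k < n then x k else e' (k - n)) p)"
proof -
  obtain p r where p: "C p" "\<And>e. P e \<longleftrightarrow> sem (\<lambda>k. ev e (r k)) p"
    using assms(1) by (auto simp: definable_def)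
  define f where "f k = (case r k of Inl j \<Rightarrow> if j < n then Var j else Var (k + n) | Inr c \<Rightarrow> Var (k + n))"
    for k
  define e' where "e' k = (case r k of Inl j \<Rightarrow> 0 | Inr c \<Rightarrow> c)" for k
  have "sem_tm (\<lambda>k. if k < n then x k else e' (k - n)) (f k) = ev (\<lambda>k. if k < n then x k else 0) (r k)"
    for x k
    by (auto simp: f_def e'_def split: sum.split)
  then have "P (\<lambda>k. if k < n then x k else 0) \<longleftrightarrow>
    sem (\<lambda>k. if k < n then x k else e' (k - n)) (subst f p)" for x
    by (simp add: p(2) sem_subst)
  then show ?thesis using C[OF p(1)] by blast
qed

section \<open>Arithmetic in models of $I\Sigma_1$\<close>

text \<open>An ordered semiring need be neither nonnegative nor discrete, so these two properties of
  the model are listed beside induction. The argument \<open>ty\<close> fixes the carrier, so that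
  the locale can be interpreted at a type.\<close>

locale isigma1 =
  fixes ty :: "'a::linordered_semidom itself"
  assumes nonneg [simp, intro]: "0 \<le> (x :: 'a)"
    and discrete: "0 < x \<Longrightarrow> 1 \<le> (x :: 'a)"
    and induction: "Sigma1 p \<Longrightarrow> sem (0 ## e) p \<Longrightarrow> (\<And>y :: 'a. sem (y ## e) p \<Longrightarrow> sem ((y + 1) ## e) p) \<Longrightarrow>
      sem (x ## e) p"
begin

section \<open>Order in a discretely ordered semiring\<close>

lemma add_one_le [simp]: "x + 1 \<le> y \<longleftrightarrow> x < (y :: 'a)"
proof
  assume "x < y"
  then have "0 < y - x" using le_add_diff_inverse2[of x y] by (metis add_0 less_le nonneg)
  then have "x + 1 \<le> x + (y - x)" using discrete by simp
  also have "\<dots> = y" using \<open>x < y\<close> by (simp add: add.commute)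
  finally show "x + 1 \<le> y" .
qed (use less_add_one less_le_trans in blast)

lemma less_add_one_iff [simp]: "x < y + 1 \<longleftrightarrow> x \<le> (y :: 'a)"
  using add_one_le[of y x] by (metis not_le)

lemma less_one_iff [simp]: "x < 1 \<longleftrightarrow> x = (0 :: 'a)"
  using less_add_one_iff[of x 0] by (auto simp: antisym)

lemma le_add [simp]: "x \<le> x + (y :: 'a)" "x \<le> y + x"
  by (simp_all add: add_increasing add_increasing2)

lemma not_zero_less [simp]: "\<not> 0 < x \<longleftrightarrow> x = (0 :: 'a)" "x \<le> 0 \<longleftrightarrow> x = (0 :: 'a)" "\<not> x < (0 :: 'a)"
  by (auto simp: not_less antisym)

lemma le_mult: "0 < y \<Longrightarrow> x \<le> x * (y :: 'a)"
  using mult_left_mono[of 1 y x] discrete by simp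

lemma less_imp_add: "x < (y :: 'a) \<Longrightarrow> \<exists>z. y = x + z + 1"
  using le_add_diff_inverse2[of "x + 1" y] by (metis add.assoc add.commute add_one_le)

lemma le_imp_add: "x \<le> (y :: 'a) \<Longrightarrow> \<exists>z. y = x + z"
  using le_add_diff_inverse2[of x y] by (metis add.commute)

lemma pos_imp_add: "0 < (x :: 'a) \<Longrightarrow> \<exists>z. x = z + 1"
  using less_imp_add[of 0 x] by simp

text \<open>Parameters from the model are allowed: \<open>definable_formula\<close> turns the
  predicate into a formula and an assignment holding its parameters, and the induction scheme is
  applied at that assignment.\<close>

lemma sigma_induct:
  assumes "sigma (\<lambda>e. P (e 0))" "P (0 :: 'a)" "\<And>x. P x \<Longrightarrow> P (x + 1)"
  shows "P x"
proof -
  obtain p and e' :: "nat \<Rightarrow> 'a" where p: "Sigma1 p"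
    "\<And>x. P (if 0 < Suc 0 then x 0 else 0) \<longleftrightarrow> sem (\<lambda>k. if k < Suc 0 then x k else e' (k - Suc 0)) p"
    using definable_formula[OF assms(1) Sigma1_subst, of "Suc 0"] by metis
  have "(\<lambda>k. if k < Suc 0 then x else e' (k - Suc 0)) = x ## e'" for x
    by (rule ext) (simp split: nat.split)
  then have P: "P x \<longleftrightarrow> sem (x ## e') p" for x using p(2)[of "\<lambda>_. x"] by simp
  show ?thesis using induction[OF p(1), of e' x] assms(2,3) unfolding P by blast
qed

text \<open>The bound is enlarged for one \<open>x\<close> at a time. That the induction predicate
  is Sigma_1 is a hypothesis here because closure of \<open>sigma\<close> under bounded quantifiers
  is itself derived from this lemma.\<close>

lemma collection_aux:
  assumes "sigma (\<lambda>e. \<exists>b. \<forall>x<e 0. x < a \<longrightarrow> (\<exists>y<b. Q x (y :: 'a)))" "\<And>x. x < a \<Longrightarrow> \<exists>y. Q x y"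
  shows "\<exists>b. \<forall>x<(a :: 'a). \<exists>y<b. Q x y"
proof -
  have "\<exists>b. \<forall>x<n. x < a \<longrightarrow> (\<exists>y<b. Q x y)" for n
  proof (rule sigma_induct[where P = "\<lambda>n. \<exists>b. \<forall>x<n. x < a \<longrightarrow> (\<exists>y<b. Q x y)"])
    fix n assume "\<exists>b. \<forall>x<n. x < a \<longrightarrow> (\<exists>y<b. Q x y)"
    then obtain b where b: "\<And>x. x < n \<Longrightarrow> x < a \<Longrightarrow> \<exists>y<b. Q x y" by blast
    show "\<exists>b. \<forall>x<n + 1. x < a \<longrightarrow> (\<exists>y<b. Q x y)"
    proof (cases "n < a")
      case True
      then obtain z where z: "Q n z" using assms(2) by blast
      have "\<exists>y<max b (z + 1). Q x y" if x: "x \<le> n" "x < a" for x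
      proof (cases "x = n")
        case True
        then show ?thesis using z by (intro exI[of _ z]) (simp add: less_max_iff_disj)
      next
        case False
        then have "x < n" using x(1) by simp
        then obtain y where "y < b" "Q x y" using b x(2) by blast
        then show ?thesis by (intro exI[of _ y]) (simp add: less_max_iff_disj)
      qed
      then show ?thesis by auto
    next
      case False
      then show ?thesis using b by (intro exI[of _ b]) auto
    qed
  qed (use assms(1) in auto)
  then show ?thesis by blast
qed

text \<open>Collection provides a common bound for the witnesses of all \<open>x < f e\<close>, so
  one existential quantifier moves to the front and the remaining matrix is bounded.\<close>

lemma sigma_ball [intro!]:
  fixes f :: "(nat \<Rightarrow> 'a) \<Rightarrow> 'a"
  assumes "sigma (\<lambda>e. R (\<lambda>k. e (Suc k)) (e 0))" "tfun f"
  shows "sigma (\<lambda>e. \<forall>x. x < f e \<longrightarrow> R e x)"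
proof -
  obtain Q where Q: "delta (\<lambda>e. Q (\<lambda>k. e (Suc k)) (e 0))"
    "\<And>e. R (\<lambda>k. e (Suc k)) (e 0) \<longleftrightarrow> (\<exists>y. Q e y)"
    using sigma_prenex[OF assms(1)] by blast
  have R: "R e x \<longleftrightarrow> (\<exists>y. Q (x ## e) y)" for e x using Q(2)[of "x ## e"] by simp
  have d: "delta (\<lambda>e. Q (g e) (e 0))" if "\<And>k. tfun (\<lambda>e. g e k)" for g
    using delta_comp[OF Q(1), of "(\<lambda>e. e 0) ## (\<lambda>k e. g e k)"] that
    by (simp add: tfun_var split: nat.split)
  have "(\<forall>x. x < f e \<longrightarrow> R e x) \<longleftrightarrow> (\<exists>b. \<forall>x<f e. \<exists>y<b. Q (x ## e) y)" for e
  proof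
    assume *: "\<forall>x. x < f e \<longrightarrow> R e x"
    have "delta (\<lambda>e'. Q (e' (Suc 0) ## e) (e' 0))"
    proof (rule d)
      show "tfun (\<lambda>e'. (e' (Suc 0) ## e) k)" for k by (cases k) auto
    qed
    then have "sigma (\<lambda>e'. \<exists>b. \<forall>x<e' 0. x < f e \<longrightarrow> (\<exists>y<b. Q (x ## e) y))"
      by (intro sigma_ex sigma_delta delta_ball delta_imp delta_bex delta_less tfun_var tfun_const)
    then show "\<exists>b. \<forall>x<f e. \<exists>y<b. Q (x ## e) y"
      using * R by (intro collection_aux) auto
  qed (use R in blast)
  moreover have "delta (\<lambda>e. Q (e (Suc 0) ## (\<lambda>k. e (Suc (Suc (Suc k))))) (e 0))"
  proof (rule d)
    show "tfun (\<lambda>e. (e (Suc 0) ## (\<lambda>k. e (Suc (Suc (Suc k))))) k)" for k by (cases k) auto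
  qed
  then have "sigma (\<lambda>e. \<exists>b. \<forall>x<f e. \<exists>y<b. Q (x ## e) y)"
    using tfun_shift[OF assms(2)] by (intro sigma_ex sigma_delta delta_ball delta_bex tfun_var)
  ultimately show ?thesis by simp
qed

text \<open>It is the complement that has to be Sigma_1: the induction runs on the absence of
  elements below \<open>n\<close>.\<close>

lemma least_ex:
  assumes "sigma (\<lambda>e. \<not> P (e 0))" "P (x :: 'a)"
  obtains m where "P m" "\<And>y. y < m \<Longrightarrow> \<not> P y"
proof (rule ccontr)
  assume "\<not> thesis"
  with that have step: "\<not> P m" if "\<And>y. y < m \<Longrightarrow> \<not> P y" for m using that by blast
  have "\<forall>y<n. \<not> P y" for n
  proof (rule sigma_induct[where P = "\<lambda>n. \<forall>y<n. \<not> P y"])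
    show "sigma (\<lambda>e. \<forall>y<e 0. \<not> P y)"
      by (intro sigma_ball tfun_var assms(1))
  qed (use step in \<open>auto simp: le_less\<close>)
  then show False using assms(2) less_add_one by blast
qed

section \<open>Division with remainder and pairing\<close>

lemma division: "0 < m \<Longrightarrow> \<exists>q r. x = q * m + r \<and> r < (m :: 'a)"
proof (rule sigma_induct[where P = "\<lambda>x. \<exists>q r. x = q * m + r \<and> r < m"])
  fix x assume "\<exists>q r. x = q * m + r \<and> r < m" "0 < m"
  then obtain q r where x: "x = q * m + r" "r < m" by blast
  show "\<exists>q r. x + 1 = q * m + r \<and> r < m"
  proof (cases "r + 1 = m")
    case True
    have "x + 1 = q * m + (r + 1)" using x by (simp add: algebra_simps)
    also have "\<dots> = (q + 1) * m + 0" unfolding True by (simp add: algebra_simps)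
    finally have "x + 1 = (q + 1) * m + 0" .
    then show ?thesis using \<open>0 < m\<close> by blast
  next
    case False
    then have "r + 1 < m" using x(2) by (simp add: less_le)
    moreover have "x + 1 = q * m + (r + 1)" using x by (simp add: algebra_simps)
    ultimately show ?thesis by blast
  qed
next
  show "0 < m \<Longrightarrow> \<exists>q r. 0 = q * m + r \<and> r < m" by (intro exI[of _ 0]) simp
qed (intro sigma_ex sigma_conj sigma_eq sigma_less tfun_var tfun_const tfun_add tfun_mult)

lemma division_less:
  assumes "r < m" "q < q'"
  shows "q * m + r < q' * m + (r' :: 'a)"
proof -
  have "q * m + r < (q + 1) * m" using assms(1) by (simp add: algebra_simps)
  also have "\<dots> \<le> q' * m" using assms(2) by (intro mult_right_mono) simp_all
  also have "\<dots> \<le> q' * m + r'" by simp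
  finally show ?thesis .
qed

lemma division_unique:
  "q * m + r = q' * m + r' \<Longrightarrow> r < m \<Longrightarrow> r' < m \<Longrightarrow> q = q' \<and> r = (r' :: 'a)"
  using division_less[of r m q q' r'] division_less[of r' m q' q r]
  by (cases q q' rule: linorder_cases) auto

definition pr :: "'a \<Rightarrow> 'a \<Rightarrow> 'a" where
  "pr x y = (x + y) * (x + y) + x"

lemma pr_le: "x \<le> pr x y" "y \<le> pr x y"
proof -
  show "x \<le> pr x y" by (simp add: pr_def)
  have "x + y \<le> (x + y) * (x + y)"
    using le_mult[of "x + y" "x + y"] by (cases "x + y = 0") (auto simp: less_le)
  then have "y \<le> (x + y) * (x + y)" by (rule order_trans[rotated]) simp
  also have "\<dots> \<le> pr x y" by (simp add: pr_def)
  finally show "y \<le> pr x y" .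
qed

text \<open>\<open>pr x y\<close> lies between the square of \<open>x + y\<close> and the next
  square, so the sum of the components decides the order.\<close>

lemma pr_mono: "x + y < x' + y' \<Longrightarrow> pr x y < pr x' y'"
proof -
  assume less: "x + y < x' + y'"
  have "pr x y \<le> (x + y) * (x + y) + (x + y)" by (simp add: pr_def)
  also have "\<dots> < (x + y + 1) * (x + y + 1)"
  proof -
    have "(x + y + 1) * (x + y + 1) = ((x + y) * (x + y) + (x + y)) + (x + y) + 1"
      by (simp add: algebra_simps)
    then show ?thesis by simp
  qed
  also have "\<dots> \<le> (x' + y') * (x' + y')" using less by (intro mult_mono) simp_all
  also have "\<dots> \<le> pr x' y'" by (simp add: pr_def)
  finally show ?thesis .
qed

lemma pr_inject [simp]: "pr x y = pr x' y' \<longleftrightarrow> x = x' \<and> y = y'"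
proof
  assume eq: "pr x y = pr x' y'"
  then have s: "x + y = x' + y'"
    using pr_mono[of x y x' y'] pr_mono[of x' y' x y] by (cases "x + y" "x' + y'" rule: linorder_cases) auto
  then have "x = x'" using eq by (simp add: pr_def)
  then show "x = x' \<and> y = y'" using s by simp
qed simp

text \<open>Makes 0 a code of the empty sequence, below every possible first entry of an
  approximation.\<close>

lemma pr_zero [simp]: "pr 0 0 = 0"
  by (simp add: pr_def)

lemma tfun_pr [intro!]: "tfun f \<Longrightarrow> tfun g \<Longrightarrow> tfun (\<lambda>e. pr (f e) (g e))"
  unfolding pr_def by (intro tfun_add tfun_mult)

section \<open>Sequences and finite sets\<close>

text \<open>This predicate and those after it copy the formal definitions quantifier by quantifier,
  so that unfolding identifies a formula with its meaning in the model.\<close>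

definition lth :: "'a \<Rightarrow> 'a \<Rightarrow> bool" where
  "lth s n \<longleftrightarrow> (\<exists>a b. s = pr n (pr a b))"

definition is_seq :: "'a \<Rightarrow> bool" where
  "is_seq s \<longleftrightarrow> (\<exists>n. lth s n)"

definition beta :: "'a \<Rightarrow> 'a \<Rightarrow> 'a \<Rightarrow> 'a \<Rightarrow> bool" where
  "beta a b i v \<longleftrightarrow> v < 1 + (i + 1) * b \<and> (\<exists>q. a = q * (1 + (i + 1) * b) + v)"

definition entry :: "'a \<Rightarrow> 'a \<Rightarrow> 'a \<Rightarrow> bool" where
  "entry s i v \<longleftrightarrow> (\<exists>n a b. s = pr n (pr a b) \<and> i < n \<and> beta a b i v)"

definition initseg :: "'a \<Rightarrow> 'a \<Rightarrow> bool" where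
  "initseg s t \<longleftrightarrow> (\<exists>m n. lth s m \<and> lth t n \<and> m \<le> n) \<and> (\<forall>i v. entry s i v \<longrightarrow> entry t i v)"

definition seqeq :: "'a \<Rightarrow> 'a \<Rightarrow> bool" where
  "seqeq s t \<longleftrightarrow> initseg s t \<and> initseg t s"

definition finset :: "'a \<Rightarrow> bool" where
  "finset c \<longleftrightarrow> is_seq c \<and> (\<forall>i v. entry c i v \<longrightarrow> is_seq v)"

definition mem :: "'a \<Rightarrow> 'a \<Rightarrow> bool" where
  "mem t c \<longleftrightarrow> (\<exists>i v. entry c i v \<and> seqeq v t)"

definition is_finite :: "('a \<Rightarrow> bool) \<Rightarrow> bool" where
  "is_finite P \<longleftrightarrow> (\<exists>c. finset c \<and> (\<forall>t. P t \<longleftrightarrow> mem t c))"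

lemma beta_le: "beta a b i v \<Longrightarrow> v \<le> a" "a = q * (1 + (i + 1) * b) + v \<Longrightarrow> q \<le> a"
proof -
  show "beta a b i v \<Longrightarrow> v \<le> a" by (auto simp: beta_def)
  have "q \<le> q * (1 + (i + 1) * b)"
    by (rule le_mult) (rule less_le_trans[OF zero_less_one], simp)
  also have "\<dots> \<le> q * (1 + (i + 1) * b) + v" by simp
  finally show "a = q * (1 + (i + 1) * b) + v \<Longrightarrow> q \<le> a" by simp
qed

lemma beta_ex: "\<exists>v. beta a b i v"
proof -
  have "0 < 1 + (i + 1) * b" by (rule less_le_trans[OF zero_less_one]) simp
  then show ?thesis unfolding beta_def using division[of "1 + (i + 1) * b" a] by blast
qed

lemma beta_unique: "beta a b i v \<Longrightarrow> beta a b i w \<Longrightarrow> v = w"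
  unfolding beta_def using division_unique by blast

lemma lth_unique: "lth s m \<Longrightarrow> lth s n \<Longrightarrow> m = n"
  by (auto simp: lth_def)

lemma lth_le: "lth s n \<Longrightarrow> n \<le> s"
  by (auto simp: lth_def pr_le)

lemma entry_unique: "entry s i v \<Longrightarrow> entry s i w \<Longrightarrow> v = w"
  by (auto simp: entry_def beta_unique)

lemma entry_ex: "lth s n \<Longrightarrow> i < n \<Longrightarrow> \<exists>v. entry s i v"
  unfolding lth_def entry_def using beta_ex by blast

lemma entry_lth: "entry s i v \<Longrightarrow> \<exists>n. lth s n \<and> i < n"
  by (auto simp: lth_def entry_def)

lemma entry_less_lth: "entry s i v \<Longrightarrow> lth s n \<Longrightarrow> i < n"
  using entry_lth lth_unique by blast

lemma pr_pr_le: "n \<le> pr n (pr a b)" "a \<le> pr n (pr a b)" "b \<le> pr n (pr a b)"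
  by (auto intro: pr_le order_trans[OF pr_le(1) pr_le(2)] order_trans[OF pr_le(2) pr_le(2)])

lemma entry_le: "entry s i v \<Longrightarrow> v \<le> s" "entry s i v \<Longrightarrow> i \<le> s"
  unfolding entry_def using beta_le(1) pr_pr_le by (meson order_trans less_imp_le)+

text \<open>A pair is at least as large as its components, so the witnesses are bounded by the code
  itself. Such bounded forms place the coding predicates among the \<open>delta\<close>
  ones.\<close>

lemma lth_bounded: "lth s n \<longleftrightarrow> (\<exists>a<s + 1. \<exists>b<s + 1. s = pr n (pr a b))"
  using pr_pr_le by (auto simp: lth_def)

lemma is_seq_bounded: "is_seq s \<longleftrightarrow> (\<exists>n<s + 1. lth s n)"
  using lth_le by (auto simp: is_seq_def)

lemma entry_bounded: "entry s i v \<longleftrightarrow> (\<exists>n<s + 1. \<exists>a<s + 1. \<exists>b<s + 1. s = pr n (pr a b) \<and> i < n \<and>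
    v < 1 + (i + 1) * b \<and> (\<exists>q<s + 1. a = q * (1 + (i + 1) * b) + v))" (is "_ \<longleftrightarrow> ?r")
proof
  assume "entry s i v"
  then obtain n a b q where *: "s = pr n (pr a b)" "i < n" "v < 1 + (i + 1) * b"
      "a = q * (1 + (i + 1) * b) + v"
    by (auto simp: entry_def beta_def)
  have "n \<le> s" "a \<le> s" "b \<le> s" unfolding *(1) by (rule pr_pr_le)+
  moreover have "q \<le> s" using beta_le(2)[OF *(4)] \<open>a \<le> s\<close> by (rule order_trans)
  ultimately show ?r using * unfolding less_add_one_iff by blast
qed (auto simp: entry_def beta_def)

lemma delta_lth [intro!]: "tfun f \<Longrightarrow> tfun g \<Longrightarrow> delta (\<lambda>e. lth (f e) (g e))"
  by (rule definable_comp2[where P = lth], unfold lth_bounded)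
    (intro delta_bex delta_eq tfun_add tfun_pr tfun_var tfun_const Delta0_subst | assumption)+

lemma delta_is_seq [intro!]: "tfun f \<Longrightarrow> delta (\<lambda>e. is_seq (f e))"
  by (rule definable_comp1[where P = is_seq], unfold is_seq_bounded)
    (intro delta_bex delta_lth tfun_add tfun_var tfun_const Delta0_subst | assumption)+

lemma delta_entry [intro!]: "tfun f \<Longrightarrow> tfun g \<Longrightarrow> tfun h \<Longrightarrow> delta (\<lambda>e. entry (f e) (g e) (h e))"
  by (rule definable_comp3[where P = entry], unfold entry_bounded)
    (intro delta_bex delta_conj delta_less delta_eq tfun_add tfun_mult tfun_pr tfun_var tfun_const
      Delta0_subst | assumption)+

lemma initseg_bounded: "initseg s t \<longleftrightarrow> (\<exists>m<s + 1. \<exists>n<t + 1. lth s m \<and> lth t n \<and> m \<le> n) \<and>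
    (\<forall>i<s + 1. \<forall>v<s + 1. entry s i v \<longrightarrow> entry t i v)"
  unfolding initseg_def less_add_one_iff using lth_le entry_le by blast

lemma delta_initseg [intro!]: "tfun f \<Longrightarrow> tfun g \<Longrightarrow> delta (\<lambda>e. initseg (f e) (g e))"
  by (rule definable_comp2[where P = initseg], unfold initseg_bounded)
    (intro delta_bex delta_ball delta_conj delta_imp delta_le delta_lth delta_entry tfun_add tfun_var
      tfun_const Delta0_subst | assumption)+

lemma delta_seqeq [intro!]: "tfun f \<Longrightarrow> tfun g \<Longrightarrow> delta (\<lambda>e. seqeq (f e) (g e))"
  unfolding seqeq_def by (intro delta_conj delta_initseg)

lemma mem_bounded: "mem t c \<longleftrightarrow> (\<exists>i<c + 1. \<exists>v<c + 1. entry c i v \<and> seqeq v t)"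
  unfolding mem_def less_add_one_iff using entry_le by blast

lemma delta_mem [intro!]: "tfun f \<Longrightarrow> tfun g \<Longrightarrow> delta (\<lambda>e. mem (f e) (g e))"
  by (rule definable_comp2[where P = mem], unfold mem_bounded)
    (intro delta_bex delta_conj delta_seqeq delta_entry tfun_add tfun_var tfun_const Delta0_subst
      | assumption)+

lemmas sigma_seq [intro!] =
  sigma_delta[OF delta_lth] sigma_delta[OF delta_is_seq] sigma_delta[OF delta_entry]
  sigma_delta[OF delta_initseg] sigma_delta[OF delta_seqeq] sigma_delta[OF delta_mem]

section \<open>Coding definable sequences\<close>

text \<open>Takes the place of the factorial: multiplying by \<open>n + 1\<close> adds one
  divisor.\<close>

lemma common_multiple: "\<exists>b. 0 < b \<and> (\<forall>t<n + 1. 0 < t \<longrightarrow> (\<exists>c. b = t * (c :: 'a)))"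
proof (rule sigma_induct[where P = "\<lambda>n. \<exists>b. 0 < b \<and> (\<forall>t<n + 1. 0 < t \<longrightarrow> (\<exists>c. b = t * (c :: 'a)))"])
  show "\<exists>b. 0 < b \<and> (\<forall>t<0 + 1. 0 < t \<longrightarrow> (\<exists>c. b = t * (c :: 'a)))"
    by (intro exI[of _ 1]) auto
next
  fix n assume "\<exists>b. 0 < b \<and> (\<forall>t<n + 1. 0 < t \<longrightarrow> (\<exists>c. b = t * (c :: 'a)))"
  then obtain b where b: "0 < b" "\<And>t. t \<le> n \<Longrightarrow> 0 < t \<Longrightarrow> \<exists>c. b = t * c" by auto
  have "\<exists>c. b * (n + 1) = t * c" if t: "t \<le> n + 1" "0 < t" for t
  proof (cases "t = n + 1")
    case True
    then show ?thesis by (auto intro: exI[of _ b] simp: mult.commute)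
  next
    case False
    then have "t \<le> n" using t(1) by (simp add: le_less)
    then show ?thesis using b(2) t(2) by (metis mult.assoc)
  qed
  moreover have "0 < b * (n + 1)"
    using b(1) by (intro mult_pos_pos) (auto intro: less_le_trans[OF zero_less_one])
  ultimately show "\<exists>b. 0 < b \<and> (\<forall>t<n + 1 + 1. 0 < t \<longrightarrow> (\<exists>c. b = t * (c :: 'a)))"
    by auto
qed (intro sigma_ex sigma_conj sigma_less sigma_ball sigma_imp delta_less sigma_eq tfun_add tfun_mult
    tfun_var tfun_const)

text \<open>Let \<open>N = (j + 1) * b\<close> and compute modulo \<open>1 + N\<close>. The modulus
  of \<open>k\<close> times \<open>j + 1\<close> is congruent to \<open>t\<close>; a further factor
  \<open>c * (j + 1)\<close> gives \<open>N\<close>, which is congruent to -1. One more factor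
  \<open>N\<close> gives 1, and no negative numbers are needed.\<close>

lemma modulus_inverse:
  fixes b c k t :: 'a
  assumes "0 < b" "b = t * c" and j: "j = k + t"
  shows "\<exists>u w. u * (1 + (k + 1) * b) = w * (1 + (j + 1) * b) + 1"
proof -
  define N where "N = (j + 1) * b"
  define x where "x = c * (j + 1) * (k + 1)"
  have "0 < N"
    unfolding N_def using assms(1) by (intro mult_pos_pos) (auto intro: less_le_trans[OF zero_less_one])
  then obtain N' where N': "N = N' + 1" using pos_imp_add by blast
  have "(j + 1) * (1 + (k + 1) * b) = (k + 1) * (1 + N) + t"
    by (simp add: j N_def algebra_simps)
  then have "c * (j + 1) * (j + 1) * (1 + (k + 1) * b) = c * (j + 1) * ((k + 1) * (1 + N) + t)"
    by (simp add: mult.assoc)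
  also have "\<dots> = x * (1 + N) + N"
    by (simp add: x_def N_def assms(2) algebra_simps)
  finally have "N * (c * (j + 1) * (j + 1)) * (1 + (k + 1) * b) = N * (x * (1 + N) + N)"
    by (simp add: mult.assoc)
  also have "\<dots> = N * x * (1 + N) + N * N" by (simp add: algebra_simps)
  also have "N * N = N' * (1 + N) + 1"
    by (simp add: N' algebra_simps)
  also have "N * x * (1 + N) + (N' * (1 + N) + 1) = (N * x + N') * (1 + (j + 1) * b) + 1"
    by (simp add: N_def algebra_simps)
  finally show ?thesis by blast
qed

text \<open>The Chinese remainder theorem by induction: \<open>d\<close> is a common multiple of the moduli used so
  far and invertible modulo the others.\<close>

lemma sequence_coding:
  assumes G: "sigma (\<lambda>e. G (e 0) (e (Suc 0)))" and ex: "\<And>i. i < n \<Longrightarrow> \<exists>v. G i (v :: 'a)"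
  obtains s where "lth s n" "\<And>i. i < n \<Longrightarrow> \<exists>v. entry s i v \<and> G i v"
proof -
  have G': "sigma (\<lambda>e. G (f e) (g e))" if "tfun f" "tfun g" for f g
    by (rule definable_comp2[where P = G, OF G that Sigma1_subst])
  have "\<exists>B. \<forall>i<n. \<exists>v<B. G i v"
    using ex
    by (intro collection_aux) (intro sigma_ex sigma_ball sigma_imp sigma_conj G' sigma_less delta_less
        tfun_var tfun_const)+
  then obtain B where B: "\<And>i. i < n \<Longrightarrow> \<exists>v<B. G i v" by blast
  obtain b0 where b0: "0 < b0" "\<And>t. t \<le> n \<Longrightarrow> 0 < t \<Longrightarrow> \<exists>c. b0 = t * c"
    using common_multiple[of n] by auto
  \<comment> \<open>A multiple of every positive number up to \<open>n\<close>, which makes the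
    moduli invertible modulo each other, and larger than \<open>B\<close>, so that every modulus
    exceeds the values to be coded.\<close>
  define b where "b = b0 * (B + 1)"
  have B1: "0 < B + 1" by (rule less_le_trans[OF zero_less_one]) simp
  then have "0 < b" using b0(1) by (simp add: b_def)
  have dvd: "\<exists>c. b = t * c" if "t \<le> n" "0 < t" for t
    using b0(2)[OF that] by (auto simp: b_def mult.assoc)
  define m where "m i = 1 + (i + 1) * b" for i
  have "B < m i" for i
  proof -
    have "B + 1 \<le> b" unfolding b_def using le_mult[OF b0(1), of "B + 1"] by (simp add: mult.commute)
    also have "b \<le> (i + 1) * b" by (simp add: algebra_simps)
    also have "\<dots> \<le> m i" by (simp add: m_def)
    finally show ?thesis by simp
  qed
  define Q where "Q k \<longleftrightarrow> (\<exists>a d. (\<forall>i<k. \<exists>v. beta a b i v \<and> G i v) \<and> (\<forall>i<k. \<exists>c. d = c * m i) \<and>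
    (\<forall>j<n. k \<le> j \<longrightarrow> (\<exists>u w. u * d = w * m j + 1)))" for k
  have "k \<le> n \<longrightarrow> Q k" for k
  proof (rule sigma_induct[where P = "\<lambda>k. k \<le> n \<longrightarrow> Q k"])
    show "sigma (\<lambda>e. e 0 \<le> n \<longrightarrow> Q (e 0))"
      unfolding Q_def beta_def m_def
      by (intro sigma_imp delta_le sigma_ex sigma_conj sigma_ball G' sigma_less sigma_eq tfun_add
          tfun_mult tfun_var tfun_const)
    show "0 \<le> n \<longrightarrow> Q 0"
      unfolding Q_def by (intro impI exI[of _ 0] exI[of _ 1] conjI allI) (auto intro: exI[of _ 1] exI[of _ 0])
  next
    fix k assume IH: "k \<le> n \<longrightarrow> Q k"
    show "k + 1 \<le> n \<longrightarrow> Q (k + 1)"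
    proof
      assume "k + 1 \<le> n"
      then have k: "k < n" by simp
      then obtain a d where a: "\<And>i. i < k \<Longrightarrow> \<exists>v. beta a b i v \<and> G i v"
        and d: "\<And>i. i < k \<Longrightarrow> \<exists>c. d = c * m i"
        and inv: "\<And>j. j < n \<Longrightarrow> k \<le> j \<Longrightarrow> \<exists>u w. u * d = w * m j + 1"
        using IH unfolding Q_def by auto
      obtain u w where u: "u * d = w * m k + 1" using inv k by blast
      obtain v where v: "v < B" "G k v" using B k by blast
      \<comment> \<open>\<open>u\<close> inverts \<open>d\<close> modulo \<open>m k\<close>, so
        adding \<open>d * u * z\<close> adds \<open>z\<close>, and \<open>z\<close> is
        \<open>v - a\<close> modulo \<open>m k\<close>, written with \<open>(k + 1) * b\<close> for
        -1. The earlier moduli divide \<open>d\<close>, so the earlier remainders survive.\<close>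
      define z where "z = v + (k + 1) * b * a"
      define a' where "a' = a + d * u * z"
      have "\<exists>v. beta a' b i v \<and> G i v" if i: "i < k + 1" for i
      proof (cases "i = k")
        case True
        have "a' = a + (w * m k + 1) * z" by (simp add: a'_def u[symmetric] mult.commute)
        also have "\<dots> = (w * z + a) * m k + v"
          by (simp add: z_def m_def algebra_simps)
        finally have "beta a' b k v"
          using less_trans[OF v(1) \<open>B < m k\<close>] unfolding beta_def m_def[symmetric] by blast
        then show ?thesis using v(2) True by blast
      next
        case False
        then have "i < k" using i by simp
        then obtain q c v where q: "v < m i" "a = q * m i + v" "G i v" "d = c * m i"
          using a[of i] d[of i] by (auto simp: beta_def m_def)
        then have "a' = (q + c * u * z) * m i + v" by (simp add: a'_def algebra_simps)
        then have "beta a' b i v" using q(1) unfolding beta_def m_def[symmetric] by blast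
        then show ?thesis using q(3) by blast
      qed
      moreover have "\<exists>c. d * m k = c * m i" if "i < k + 1" for i
      proof (cases "i = k")
        case False
        then have "i < k" using that by simp
        then obtain c where "d = c * m i" using d by blast
        then have "d * m k = (c * m k) * m i" by (simp add: algebra_simps)
        then show ?thesis ..
      qed auto
      moreover have "\<exists>u w. u * (d * m k) = w * m j + 1" if j: "j < n" "k + 1 \<le> j" for j
      proof -
        have "k < j" using j(2) by simp
        then obtain t where t: "j = k + t" "0 < t"
          by (metis add.assoc less_imp_add less_add_one_iff nonneg)
        have "t \<le> n" using j(1) t(1) by (metis le_add(2) less_imp_le order_trans)
        then obtain c where "b = t * c" using dvd t(2) by blast
        \<comment> \<open>The difference \<open>t\<close> of the indices divides \<open>b\<close>,
          so \<open>m k\<close> is invertible modulo \<open>m j\<close>; the inverse of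
          \<open>d * m k\<close> is the product of the two inverses.\<close>
        then obtain u' w' where u': "u' * m k = w' * m j + 1"
          using modulus_inverse[OF \<open>0 < b\<close> _ t(1)] unfolding m_def by blast
        obtain u w where u: "u * d = w * m j + 1" 
          using inv[OF j(1) less_imp_le[OF \<open>k < j\<close>]] by blast
        have "(u * u') * (d * m k) = (u * d) * (u' * m k)" by (simp add: algebra_simps)
        also have "\<dots> = (w * w' * m j + w + w') * m j + 1"
          unfolding u u' by (simp add: algebra_simps)
        finally show ?thesis by blast
      qed
      ultimately show "Q (k + 1)" unfolding Q_def by blast
    qed
  qed
  then obtain a where "\<And>i. i < n \<Longrightarrow> \<exists>v. beta a b i v \<and> G i v" unfolding Q_def by blast
  then show thesis by (intro that[of "pr n (pr a b)"]) (auto simp: lth_def entry_def)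
qed

section \<open>Comparing sequences\<close>

lemma initseg_trans: "initseg s t \<Longrightarrow> initseg t u \<Longrightarrow> initseg s u"
proof -
  assume st: "initseg s t" and tu: "initseg t u"
  obtain m n where "lth s m" "lth t n" "m \<le> n" using st by (auto simp: initseg_def)
  moreover obtain n' k where "lth t n'" "lth u k" "n' \<le> k" using tu by (auto simp: initseg_def)
  ultimately have "lth s m \<and> lth u k \<and> m \<le> k" using lth_unique order_trans by blast
  then show ?thesis using st tu unfolding initseg_def by blast
qed

lemma initseg_refl: "is_seq s \<Longrightarrow> initseg s s"
  by (auto simp: initseg_def is_seq_def)

lemma initseg_is_seq: "initseg s t \<Longrightarrow> is_seq s" "initseg s t \<Longrightarrow> is_seq t"
  by (auto simp: initseg_def is_seq_def)

lemma initseg_le: "initseg s t \<Longrightarrow> lth s m \<Longrightarrow> lth t n \<Longrightarrow> m \<le> n"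
  unfolding initseg_def by (metis lth_unique)

lemma seqeq_refl: "is_seq s \<Longrightarrow> seqeq s s"
  by (simp add: seqeq_def initseg_refl)

lemma seqeq_sym: "seqeq s t \<Longrightarrow> seqeq t s"
  by (auto simp: seqeq_def)

lemma seqeq_trans: "seqeq s t \<Longrightarrow> seqeq t u \<Longrightarrow> seqeq s u"
  by (auto simp: seqeq_def intro: initseg_trans)

lemma seqeq_initseg: "seqeq s t \<Longrightarrow> initseg s u \<longleftrightarrow> initseg t u" "seqeq s t \<Longrightarrow> initseg u s \<longleftrightarrow> initseg u t"
  unfolding seqeq_def using initseg_trans by blast+

lemma seqeq_cong: "seqeq s t \<Longrightarrow> seqeq s u \<longleftrightarrow> seqeq t u" "seqeq s t \<Longrightarrow> seqeq u s \<longleftrightarrow> seqeq u t"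
  using seqeq_sym seqeq_trans by blast+

lemma mem_seqeq: "seqeq s t \<Longrightarrow> mem s c \<longleftrightarrow> mem t c"
  unfolding mem_def using seqeq_cong(2) by blast

lemma initseg_prefix: "m \<le> n \<Longrightarrow> initseg (pr m (pr a b)) (pr n (pr a b))"
  by (auto simp: initseg_def lth_def entry_def intro: less_le_trans)

text \<open>Truncation keeps \<open>a\<close> and \<open>b\<close> and changes only the length, so
  every initial segment, whatever its code, equals one of finitely many truncations of the given
  code.\<close>

lemma initseg_eq_prefix:
  assumes "initseg t (pr n (pr a b))" "lth t m"
  shows "m \<le> n" "seqeq (pr m (pr a b)) t"
proof -
  show "m \<le> n" using initseg_le[OF assms] by (auto simp: lth_def)
  have e: "entry (pr m (pr a b)) i v" if "entry t i v" for i v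
    using that assms entry_less_lth[OF that assms(2)] by (auto simp: initseg_def entry_def)
  moreover have "entry t i v" if *: "entry (pr m (pr a b)) i v" for i v
  proof -
    have "i < m" using * by (auto simp: entry_def)
    then obtain w where "entry t i w" using entry_ex assms(2) by blast
    then show ?thesis using e entry_unique * by blast
  qed
  ultimately show "seqeq (pr m (pr a b)) t"
    using assms(2) unfolding seqeq_def initseg_def by (auto simp: lth_def)
qed

lemma seqeq_empty: "lth s 0 \<Longrightarrow> lth t 0 \<Longrightarrow> seqeq s t"
  using entry_less_lth unfolding seqeq_def initseg_def by (metis not_zero_less(3) order_refl)

lemma is_finite_initsegs:
  assumes C: "finset C"
  shows "is_finite (\<lambda>t. \<exists>u. mem u C \<and> initseg t u)"
proof -
  obtain L where L: "lth C L" using C by (auto simp: finset_def is_seq_def)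
  \<comment> \<open>Index \<open>i * (C + 1) + m\<close> stands for member \<open>i\<close> cut to
    length \<open>m\<close>. The length of a member is at most its code, hence at most
    \<open>C\<close>, so \<open>C + 1\<close> lengths suffice.\<close>
  define N where "N = L * (C + 1)"
  \<comment> \<open>Lengths \<open>m\<close> beyond that of the member are padded with the member
    itself, which keeps \<open>G\<close> total and lists nothing but initial segments.\<close>
  define G where "G k w \<longleftrightarrow> (\<exists>i m v n a b. k = i * (C + 1) + m \<and> m < C + 1 \<and> entry C i v \<and>
    v = pr n (pr a b) \<and> (m \<le> n \<and> w = pr m (pr a b) \<or> n < m \<and> w = v))" for k w
  have seq: "\<exists>n a b. v = pr n (pr a b)" if "entry C i v" for i v
    using C that by (auto simp: finset_def is_seq_def lth_def)
  have pos: "0 < C + 1" by (rule less_le_trans[OF zero_less_one]) simp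
  have sG: "sigma (\<lambda>e. G (e 0) (e (Suc 0)))"
    unfolding G_def
    by (intro sigma_ex sigma_conj sigma_disj sigma_eq sigma_less sigma_le sigma_delta[OF delta_entry]
        tfun_pr tfun_add tfun_mult tfun_var tfun_const)
  have exG: "\<exists>w. G k w" if k: "k < N" for k
  proof -
    obtain i m where im: "k = i * (C + 1) + m" "m < C + 1" using division[OF pos] by blast
    have "i < L"
    proof (rule ccontr)
      assume "\<not> i < L"
      then have "N \<le> i * (C + 1)" unfolding N_def by (intro mult_right_mono) (simp_all add: not_less)
      also have "\<dots> \<le> k" by (simp add: im(1))
      finally show False using k by simp
    qed
    then obtain v where v: "entry C i v" using entry_ex[OF L] by blast
    then obtain n a b where nab: "v = pr n (pr a b)" using seq by blast
    define w where "w = (if m \<le> n then pr m (pr a b) else v)"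
    have "m \<le> n \<and> w = pr m (pr a b) \<or> n < m \<and> w = v" by (simp add: w_def not_le)
    then show ?thesis using im v nab unfolding G_def by blast
  qed
  obtain c where c: "lth c N" "\<And>k. k < N \<Longrightarrow> \<exists>w. entry c k w \<and> G k w"
    using sequence_coding[OF sG exG] by blast
  have entry_G: "G k w" if "entry c k w" for k w
    using c(2)[OF entry_less_lth[OF that c(1)]] entry_unique[OF that] by blast
  have G_initseg: "\<exists>i v. entry C i v \<and> initseg w v" if "G k w" for k w
    using that initseg_prefix unfolding G_def by blast
  have "finset c"
    using c(1) entry_G G_initseg initseg_is_seq(1) unfolding finset_def is_seq_def[of c] by blast
  moreover have "(\<exists>u. mem u C \<and> initseg t u) \<longleftrightarrow> mem t c" for t
  proof
    assume "\<exists>u. mem u C \<and> initseg t u"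
    then obtain i v where v: "entry C i v" "initseg t v"
      unfolding mem_def using seqeq_initseg(2) by blast
    obtain n a b where nab: "v = pr n (pr a b)" using seq v(1) by blast
    obtain m where m: "lth t m" using v(2) by (auto simp: initseg_def)
    have mn: "m \<le> n" "seqeq (pr m (pr a b)) t" using initseg_eq_prefix v(2) m unfolding nab by blast+
    have "n \<le> C" using pr_le(1)[of n "pr a b"] entry_le(1)[OF v(1)] by (simp add: nab)
    then have mC: "m < C + 1" using mn(1) by (simp add: order_trans)
    define k where "k = i * (C + 1) + m"
    have "k < N"
      using division_less[OF mC entry_less_lth[OF v(1) L], of 0] by (simp add: k_def N_def)
    then obtain w where w: "entry c k w" "G k w" using c(2) by blast
    obtain i' m' v' n' a' b' where G: "k = i' * (C + 1) + m'" "m' < C + 1" "entry C i' v'"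
        "v' = pr n' (pr a' b')" "m' \<le> n' \<and> w = pr m' (pr a' b') \<or> n' < m' \<and> w = v'"
      using w(2) unfolding G_def by blast
    have "i = i' \<and> m = m'" using division_unique[OF _ mC G(2)] G(1) unfolding k_def by blast
    then have "v' = v" "m' = m" using entry_unique G(3) v(1) by blast+
    then have "w = pr m (pr a b)" using G(4,5) mn(1) by (auto simp: nab)
    then show "mem t c" using w(1) mn(2) unfolding mem_def by blast
  next
    assume "mem t c"
    then obtain k w where w: "entry c k w" "seqeq w t" by (auto simp: mem_def)
    then obtain i v where v: "entry C i v" "initseg w v" using entry_G G_initseg by blast
    then have "mem v C" unfolding mem_def using seqeq_refl initseg_is_seq(2) by blast
    then show "\<exists>u. mem u C \<and> initseg t u" using v(2) seqeq_initseg(1)[OF w(2)] by blast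
  qed
  ultimately show ?thesis unfolding is_finite_def by blast
qed

section \<open>Monotone enumerations\<close>

definition is_enum :: "('a \<Rightarrow> 'a \<Rightarrow> bool) \<Rightarrow> bool" where
  "is_enum R \<longleftrightarrow> (\<forall>s. (\<exists>y. R s y \<and> finset y) \<and> (\<forall>y y'. R s y \<and> R s y' \<longrightarrow> y = y'))"

definition in_stage :: "('a \<Rightarrow> 'a \<Rightarrow> bool) \<Rightarrow> 'a \<Rightarrow> 'a \<Rightarrow> bool" where
  "in_stage R t s \<longleftrightarrow> (\<exists>y. R s y \<and> mem t y)"

definition enum_at :: "('a \<Rightarrow> 'a \<Rightarrow> bool) \<Rightarrow> 'a \<Rightarrow> 'a \<Rightarrow> bool" where
  "enum_at R t s \<longleftrightarrow> in_stage R t s \<and> \<not> (\<exists>r. r + 1 = s \<and> in_stage R t r)"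

definition enum_before :: "('a \<Rightarrow> 'a \<Rightarrow> bool) \<Rightarrow> 'a \<Rightarrow> 'a \<Rightarrow> bool" where
  "enum_before R t s \<longleftrightarrow> (\<exists>r. r < s \<and> enum_at R t r)"

definition in_tree :: "('a \<Rightarrow> 'a \<Rightarrow> bool) \<Rightarrow> 'a \<Rightarrow> bool" where
  "in_tree R t \<longleftrightarrow> (\<exists>s u. in_stage R u s \<and> initseg t u)"

definition longest_before :: "('a \<Rightarrow> 'a \<Rightarrow> bool) \<Rightarrow> 'a \<Rightarrow> 'a \<Rightarrow> 'a \<Rightarrow> bool" where
  "longest_before R t0 t s \<longleftrightarrow> initseg t0 t \<and> enum_before R t0 s \<and>
     (\<forall>u. initseg u t \<and> enum_before R u s \<longrightarrow> (\<forall>m n. lth u m \<and> lth t0 n \<longrightarrow> m \<le> n))"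

definition monotone_enum :: "('a \<Rightarrow> 'a \<Rightarrow> bool) \<Rightarrow> bool" where
  "monotone_enum R \<longleftrightarrow> is_enum R \<and> (\<forall>s t. in_stage R t s \<longrightarrow> in_stage R t (s + 1)) \<and>
     (\<exists>t. lth t 0 \<and> enum_at R t 0) \<and> (\<forall>s. is_finite (\<lambda>t. enum_at R t s)) \<and>
     (\<forall>s t t0. enum_at R t s \<and> longest_before R t0 t s \<longrightarrow>
       \<not> (\<exists>u. initseg t0 u \<and> \<not> seqeq u t0 \<and> enum_before R u s) \<and>
       (\<forall>u. enum_at R u s \<longrightarrow> initseg t0 u))"

definition stage_by_stage :: "('a \<Rightarrow> 'a \<Rightarrow> bool) \<Rightarrow> 'a \<Rightarrow> 'a \<Rightarrow> bool" where
  "stage_by_stage R c t \<longleftrightarrow> entry c 0 t \<and>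
     (\<forall>i u v. entry c i u \<and> entry c (i + 1) v \<longrightarrow> (\<exists>s. enum_at R u s \<and> longest_before R v u s)) \<and>
     (\<exists>n v. lth c (n + 1) \<and> entry c n v \<and> lth v 0)"

definition bounded_by :: "('a \<Rightarrow> 'a \<Rightarrow> bool) \<Rightarrow> 'a \<Rightarrow> bool" where
  "bounded_by R b \<longleftrightarrow> (\<forall>t. (\<exists>s. in_stage R t s) \<longrightarrow> (\<exists>c n. stage_by_stage R c t \<and> lth c n \<and> n \<le> b))"

definition approx :: "('a \<Rightarrow> 'a \<Rightarrow> bool) \<Rightarrow> 'a \<Rightarrow> bool" where
  "approx P s \<longleftrightarrow> is_seq s \<and> (\<forall>i u v. entry s i u \<and> entry s (i + 1) v \<longrightarrow>
     (\<forall>x y. x \<le> u \<and> P x y \<longrightarrow> y \<le> v))"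

lemma in_stage_seqeq: "seqeq t u \<Longrightarrow> in_stage R t s \<longleftrightarrow> in_stage R u s"
  by (simp add: in_stage_def mem_seqeq)

end

locale isigma1_monotone_enum = isigma1 ty for ty :: "'a::linordered_semidom itself" +
  fixes R :: "'a \<Rightarrow> 'a \<Rightarrow> bool"
  assumes delta_R: "delta (\<lambda>e. R (e 0) (e (Suc 0)))" and R: "monotone_enum R"
begin

lemma delta_R' [intro!]: "tfun f \<Longrightarrow> tfun g \<Longrightarrow> delta (\<lambda>e. R (f e) (g e))"
  by (rule definable_comp2[where P = R, OF delta_R _ _ Delta0_subst])

lemmas sigma_R [intro!] = sigma_delta[OF delta_R']

lemma R_ex: "\<exists>y. R s y \<and> finset y"
  using R by (simp add: monotone_enum_def is_enum_def)

lemma R_unique: "R s y \<Longrightarrow> R s y' \<Longrightarrow> y = y'"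
  using R unfolding monotone_enum_def is_enum_def by blast

lemma in_stage_mono:
  assumes "in_stage R t s" "s \<le> s'"
  shows "in_stage R t s'"
proof -
  obtain z where z: "s' = s + z" using le_imp_add[OF assms(2)] by blast
  have "in_stage R t (s + z)"
  proof (rule sigma_induct[where P = "\<lambda>z. in_stage R t (s + z)"])
    show "sigma (\<lambda>e. in_stage R t (s + e 0))"
      unfolding in_stage_def
      by (intro sigma_ex sigma_conj sigma_R sigma_delta[OF delta_mem] tfun_add tfun_var tfun_const)
    show "in_stage R t (s + x) \<Longrightarrow> in_stage R t (s + (x + 1))" for x
      using R unfolding monotone_enum_def by (metis add.assoc)
  qed (simp add: assms(1))
  then show ?thesis by (simp add: z)
qed

text \<open>A sequence that is present has a first stage by the least number principle. The
  principle applies because absence is Sigma_1 too: E[q] is unique, so absence says that some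
  \<open>y\<close> is E[q] and misses \<open>t\<close>.\<close>

lemma enum_before_iff: "enum_before R t s \<longleftrightarrow> (\<exists>r<s. in_stage R t r)"
proof
  assume "\<exists>r<s. in_stage R t r"
  then obtain r where r: "r < s" "in_stage R t r" by blast
  have "\<not> in_stage R t q \<longleftrightarrow> (\<exists>y. R q y \<and> \<not> mem t y)" for q
    unfolding in_stage_def using R_ex R_unique by blast
  then have "sigma (\<lambda>e. \<not> in_stage R t (e 0))"
    by (simp only:) (intro sigma_ex sigma_conj sigma_R sigma_not delta_mem tfun_var tfun_const)
  from least_ex[of "in_stage R t", OF this r(2)]
  obtain m where m: "in_stage R t m" "\<And>q. q < m \<Longrightarrow> \<not> in_stage R t q" by blast
  then have "enum_at R t m" unfolding enum_at_def using less_add_one by blast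
  moreover have "m \<le> r" using m(2) r(2) not_le by blast
  ultimately show "enum_before R t s" using r(1) unfolding enum_before_def by (meson le_less_trans)
qed (auto simp: enum_before_def enum_at_def)

text \<open>Stages are cumulative and membership respects equality of sequences, so an earlier copy,
  even under another code, would still be present at the predecessor of \<open>s\<close>.\<close>

lemma enum_at_not_seqeq:
  assumes "enum_at R u s" "enum_before R v s"
  shows "\<not> seqeq u v"
proof
  assume "seqeq u v"
  obtain r where "r < s" "in_stage R v r" using assms(2) by (auto simp: enum_before_iff)
  then obtain z where z: "s = r + z + 1" using less_imp_add by blast
  have "in_stage R v (r + z)" using \<open>in_stage R v r\<close> by (rule in_stage_mono) simp
  then have "in_stage R u (r + z)" using in_stage_seqeq[OF \<open>seqeq u v\<close>] by blast
  then show False using assms(1) z unfolding enum_at_def by blast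
qed

section \<open>The expansion function\<close>

definition extended :: "'a \<Rightarrow> 'a \<Rightarrow> bool" where
  "extended x c \<longleftrightarrow> (\<exists>i<c + 1. \<exists>v<c + 1. entry c i v \<and> initseg x v \<and> \<not> seqeq v x)"

text \<open>Minimality of \<open>s\<close> is stated positively, by exhibiting E[r] for each earlier
  stage, so that the graph is Sigma_1; the bounded quantifiers in \<open>extended\<close> serve the
  same end.\<close>

definition expansion :: "'a \<Rightarrow> 'a \<Rightarrow> bool" where
  "expansion x y \<longleftrightarrow> (\<exists>s c. y = pr s c \<and> R s c \<and> extended x c \<and>
     (\<forall>r<s. \<exists>d. R r d \<and> \<not> extended x d))"

lemma extended_iff: "extended x c \<longleftrightarrow> (\<exists>u. mem u c \<and> initseg x u \<and> \<not> seqeq u x)"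
proof
  assume "extended x c"
  then obtain i v where v: "entry c i v" "initseg x v" "\<not> seqeq v x" by (auto simp: extended_def)
  then have "mem v c" unfolding mem_def using seqeq_refl initseg_is_seq(2) by blast
  then show "\<exists>u. mem u c \<and> initseg x u \<and> \<not> seqeq u x" using v by blast
next
  assume "\<exists>u. mem u c \<and> initseg x u \<and> \<not> seqeq u x"
  then obtain u i v where "initseg x u" "\<not> seqeq u x" "entry c i v" "seqeq v u"
    by (auto simp: mem_def)
  then show "extended x c"
    unfolding extended_def less_add_one_iff using entry_le seqeq_initseg(2) seqeq_cong(1) by blast
qed

text \<open>Permits replacing a predecessor by whichever of its codes the approximation
  bounds.\<close>

lemma extended_seqeq: "seqeq x x' \<Longrightarrow> extended x c \<longleftrightarrow> extended x' c"
  unfolding extended_iff using seqeq_initseg(1) seqeq_cong(2) by blast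

lemma sigma_expansion: "sigma (\<lambda>e. expansion (e 0) (e (Suc 0)))"
  unfolding expansion_def extended_def
  by (intro sigma_ex sigma_conj sigma_ball sigma_not sigma_eq sigma_R sigma_delta[OF delta_bex]
      delta_bex delta_conj delta_not delta_entry delta_initseg delta_seqeq tfun_pr tfun_add tfun_var
      tfun_const)

lemma expansion_unique:
  assumes "expansion x y" "expansion x y'"
  shows "y = y'"
proof -
  obtain s c where s: "y = pr s c" "R s c" "extended x c" "\<And>r. r < s \<Longrightarrow> \<exists>d. R r d \<and> \<not> extended x d"
    using assms(1) unfolding expansion_def by blast
  obtain s' c' where s': "y' = pr s' c'" "R s' c'" "extended x c'"
      "\<And>r. r < s' \<Longrightarrow> \<exists>d. R r d \<and> \<not> extended x d"
    using assms(2) unfolding expansion_def by blast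
  have "s = s'"
    using s s' R_unique by (metis linorder_less_linear)
  then show ?thesis using s s' R_unique by blast
qed

text \<open>A newly enumerated \<open>u\<close> differs from its predecessor \<open>v\<close>, so
  \<open>v\<close> is properly extended at stage \<open>s\<close>, and by condition (3a) not before.
  The argument may be any code \<open>v'\<close> of the same sequence.\<close>

lemma expansion_enum_at:
  assumes "enum_at R u s" "longest_before R v u s" "seqeq v' v" "R s c"
  shows "expansion v' (pr s c)"
proof -
  have v: "initseg v u" "enum_before R v s" using assms(2) by (auto simp: longest_before_def)
  have "mem u c" using assms(1,4) R_unique by (auto simp: enum_at_def in_stage_def)
  then have "extended v c" using v enum_at_not_seqeq[OF assms(1)] by (auto simp: extended_iff)
  moreover have "\<exists>d. R r d \<and> \<not> extended v d" if "r < s" for r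
  proof -
    obtain d where d: "R r d" using R_ex by blast
    have "\<not> (\<exists>w. initseg v w \<and> \<not> seqeq w v \<and> enum_before R w s)"
      using R assms(1,2) unfolding monotone_enum_def by blast
    then have "\<not> extended v d"
      using d that unfolding extended_iff enum_before_iff in_stage_def by blast
    then show ?thesis using d by blast
  qed
  ultimately show ?thesis
    using assms(4) unfolding expansion_def extended_seqeq[OF assms(3)] by blast
qed

text \<open>The entries of \<open>c\<close> are followed backwards along the approximation, from the
  empty sequence up to \<open>t\<close>. Each bound reached is an entry of \<open>s\<close> and so
  at most \<open>s\<close>, which makes the code \<open>s\<close> itself a stage common to all
  sequences.\<close>

lemma stage_bound:
  assumes s: "approx expansion s" "lth s b" and c: "stage_by_stage R c t" "lth c n" "n \<le> b"
  shows "in_stage R t s"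
proof -
  obtain n' e where n': "lth c (n' + 1)" "entry c n' e" "lth e 0"
    using c(1) unfolding stage_by_stage_def by blast
  then have n: "n = n' + 1" using lth_unique c(2) by blast
  \<comment> \<open>Entry \<open>j\<close> of the approximation handles entry
    \<open>n - 1 - j\<close> of \<open>c\<close>: that sequence is present at stage
    \<open>w\<close>, and some code of it is at most \<open>w\<close>. The second part feeds the
    next application of \<open>expansion\<close>. Bounding \<open>i\<close> and \<open>u\<close>
    keeps the predicate Sigma_1.\<close>
  define P where "P j \<longleftrightarrow> (\<forall>i<n. \<forall>u<c + 1. i + j + 1 = n \<and> entry c i u \<longrightarrow>
    (\<exists>w. entry s j w \<and> in_stage R u w \<and> (\<exists>v. v < w + 1 \<and> seqeq v u)))" for j
  have P: "P j" for j
  proof (rule sigma_induct[where P = P])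
    show "sigma (\<lambda>e. P (e 0))"
      unfolding P_def in_stage_def
      by (intro sigma_ball sigma_imp sigma_ex sigma_conj sigma_less sigma_R sigma_seq delta_conj
          delta_eq delta_entry tfun_add tfun_var tfun_const)
    show "P 0"
      unfolding P_def
    proof (intro allI impI)
      fix i u assume "i + 0 + 1 = n \<and> entry c i u"
      then have u: "lth u 0" using n n' entry_unique by auto
      have "0 < b" using c(3) n by (metis le_less_trans less_add_one less_le_trans nonneg)
      then obtain w where w: "entry s 0 w" using entry_ex[OF s(2)] by blast
      obtain e where "lth e 0" "in_stage R e 0"
        using R unfolding monotone_enum_def enum_at_def by blast
      then have "in_stage R u 0" using u seqeq_empty in_stage_seqeq by blast
      then have "in_stage R u w" by (rule in_stage_mono) simp
      \<comment> \<open>The first entry of the approximation is arbitrary, but 0 never exceeds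
        it.\<close>
      moreover have "lth 0 0" unfolding lth_def by (intro exI[of _ 0]) simp
      then have "seqeq 0 u" using u by (rule seqeq_empty)
      moreover have "0 < w + 1" by simp
      ultimately show "\<exists>w. entry s 0 w \<and> in_stage R u w \<and> (\<exists>v. v < w + 1 \<and> seqeq v u)"
        using w by blast
    qed
  next
    fix j assume IH: "P j"
    show "P (j + 1)"
      unfolding P_def
    proof (intro allI impI)
      fix i u assume iu: "i + (j + 1) + 1 = n \<and> entry c i u"
      then have ij: "i + 1 + j + 1 = n" by (simp add: algebra_simps)
      have i1: "i + 1 < n" unfolding ij[symmetric] by simp
      then obtain v where v: "entry c (i + 1) v" using entry_ex[OF c(2)] by blast
      obtain r where r: "enum_at R u r" "longest_before R v u r"
        using c(1) iu v unfolding stage_by_stage_def by blast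
      have "v < c + 1" using entry_le(1)[OF v] by simp
      then obtain w v' where w: "entry s j w" "v' < w + 1" "seqeq v' v"
        using IH ij i1 v unfolding P_def by blast
      have "j + 1 < b"
      proof -
        have "j + 1 < n" using iu by (metis add.commute le_add(1) less_add_one_iff)
        then show ?thesis using c(3) by (rule less_le_trans)
      qed
      then obtain w' where w': "entry s (j + 1) w'" using entry_ex[OF s(2)] by blast
      obtain d where d: "R r d" using R_ex by blast
      have "expansion v' (pr r d)" using r w(3) d by (rule expansion_enum_at)
      \<comment> \<open>\<open>v'\<close> is at most entry \<open>j\<close>, so the next entry
        bounds the stage \<open>r\<close> together with the set \<open>d\<close>, which is
        E[r].\<close>
      then have le: "pr r d \<le> w'" using s(1) w(1,2) w' unfolding approx_def less_add_one_iff by blast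
      have "r \<le> w'" "d \<le> w'" using pr_le[of r d] pr_le[of d r] le order_trans pr_le by blast+
      have "in_stage R u r" using r(1) by (simp add: enum_at_def)
      then have "in_stage R u w'" using \<open>r \<le> w'\<close> by (rule in_stage_mono)
      \<comment> \<open>\<open>d\<close> lists \<open>u\<close> under some code \<open>u'\<close>,
        and being an entry of \<open>d\<close> this code is at most \<open>w'\<close>.\<close>
      moreover obtain k u' where u': "entry d k u'" "seqeq u' u"
        using \<open>in_stage R u r\<close> d R_unique unfolding in_stage_def mem_def by blast
      have "u' < w' + 1" using entry_le(1)[OF u'(1)] \<open>d \<le> w'\<close> by (simp add: order_trans)
      ultimately show "\<exists>w. entry s (j + 1) w \<and> in_stage R u w \<and> (\<exists>v. v < w + 1 \<and> seqeq v u)"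
        using w' u'(2) by blast
    qed
  qed
  have t: "entry c 0 t" using c(1) by (simp add: stage_by_stage_def)
  then have "0 < n" "t < c + 1" using entry_less_lth[OF _ c(2)] entry_le by auto
  moreover have "0 + n' + 1 = n" by (simp add: n)
  \<comment> \<open>Index \<open>i = 0\<close>, the sequence \<open>t\<close> itself, is reached at
    \<open>j = n - 1\<close>.\<close>
  ultimately obtain w where "entry s n' w" "in_stage R t w"
    using P[of n'] t unfolding P_def by blast
  then show ?thesis using in_stage_mono entry_le(1) by blast
qed

theorem in_tree_finite:
  assumes "approx expansion s" "lth s b" "bounded_by R b"
  shows "is_finite (in_tree R)"
proof -
  obtain c where c: "R s c" "finset c" using R_ex by blast
  have "in_stage R u s" if "in_stage R u r" for u r
    using assms(3) that stage_bound[OF assms(1,2)] unfolding bounded_by_def by blast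
  then have "in_tree R t \<longleftrightarrow> (\<exists>u. mem u c \<and> initseg t u)" for t
    using c(1) R_unique unfolding in_tree_def in_stage_def by blast
  then show ?thesis using is_finite_initsegs[OF c(2)] by (simp add: is_finite_def)
qed

end

section \<open>Meaning of the formulas\<close>

text \<open>The parameters of \<open>p\<close> lie behind the \<open>d\<close> quantifiers already
  entered, hence the shift by \<open>d\<close>; the relation thus stays the same as further
  quantifiers are entered.\<close>

abbreviation rel :: "fm \<Rightarrow> (nat \<Rightarrow> 'a::{zero,one,plus,times,ord}) \<Rightarrow> nat \<Rightarrow> 'a \<Rightarrow> 'a \<Rightarrow> bool" where
  "rel p e d \<equiv> \<lambda>x y. sem (x ## y ## (\<lambda>k. e (k + d))) p"

lemma sem_Induction: "(\<forall>e :: nat \<Rightarrow> 'a::{zero,one,plus,times,ord}. sem e (Induction p)) \<longleftrightarrow>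
    (\<forall>e. sem ((0 :: 'a) ## e) p \<and> (\<forall>x. sem (x ## e) p \<longrightarrow> sem ((x + 1) ## e) p) \<longrightarrow>
      (\<forall>x. sem (x ## e) p))"
  by (simp add: Induction_def sem_sentence sem_app1)

context isigma1
begin

lemma sem_pair [simp]: "sem_tm e (pair x y d) = pr (sem_tm e (x d)) (sem_tm e (y d))"
  by (simp add: pair_def pr_def)

lemmas [simp] = stableD stable_Suc

lemma sem_Lth [simp]: "stable d s \<Longrightarrow> stable d n \<Longrightarrow>
    sem e (Lth s n d) \<longleftrightarrow> lth (sem_tm e (s d)) (sem_tm e (n d))"
  by (simp add: Lth_def lth_def)

lemma sem_Seq [simp]: "stable d s \<Longrightarrow> sem e (Seq s d) \<longleftrightarrow> is_seq (sem_tm e (s d))"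
  by (simp add: Seq_def is_seq_def)

lemma sem_Entry [simp]: "stable d s \<Longrightarrow> stable d i \<Longrightarrow> stable d v \<Longrightarrow>
    sem e (Entry s i v d) \<longleftrightarrow> entry (sem_tm e (s d)) (sem_tm e (i d)) (sem_tm e (v d))"
  by (simp add: Entry_def entry_def beta_def)

lemma sem_Initseg [simp]: "stable d s \<Longrightarrow> stable d t \<Longrightarrow>
    sem e (Initseg s t d) \<longleftrightarrow> initseg (sem_tm e (s d)) (sem_tm e (t d))"
  by (simp add: Initseg_def initseg_def)

lemma sem_SeqEq [simp]: "stable d s \<Longrightarrow> stable d t \<Longrightarrow>
    sem e (SeqEq s t d) \<longleftrightarrow> seqeq (sem_tm e (s d)) (sem_tm e (t d))"
  by (simp add: SeqEq_def seqeq_def)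

lemma sem_FinSet [simp]: "stable d c \<Longrightarrow> sem e (FinSet c d) \<longleftrightarrow> finset (sem_tm e (c d))"
  by (simp add: FinSet_def finset_def)

lemma sem_Mem [simp]: "stable d t \<Longrightarrow> stable d c \<Longrightarrow>
    sem e (Mem t c d) \<longleftrightarrow> mem (sem_tm e (t d)) (sem_tm e (c d))"
  by (simp add: Mem_def mem_def)

lemma sem_IsEnum [simp]: "sem e (IsEnum p d) \<longleftrightarrow> is_enum (rel p e d)"
  by (simp add: IsEnum_def is_enum_def sem_app2)

lemma sem_InStage [simp]: "stable d t \<Longrightarrow> stable d s \<Longrightarrow>
    sem e (InStage p t s d) \<longleftrightarrow> in_stage (rel p e d) (sem_tm e (t d)) (sem_tm e (s d))"
  by (simp add: InStage_def in_stage_def sem_app2)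

lemma sem_EnumAt [simp]: "stable d t \<Longrightarrow> stable d s \<Longrightarrow>
    sem e (EnumAt p t s d) \<longleftrightarrow> enum_at (rel p e d) (sem_tm e (t d)) (sem_tm e (s d))"
  by (simp add: EnumAt_def enum_at_def)

lemma sem_EnumBefore [simp]: "stable d t \<Longrightarrow> stable d s \<Longrightarrow>
    sem e (EnumBefore p t s d) \<longleftrightarrow> enum_before (rel p e d) (sem_tm e (t d)) (sem_tm e (s d))"
  by (simp add: EnumBefore_def enum_before_def)

lemma sem_InTree [simp]: "stable d t \<Longrightarrow>
    sem e (InTree p t d) \<longleftrightarrow> in_tree (rel p e d) (sem_tm e (t d))"
  by (simp add: InTree_def in_tree_def)

lemma sem_LongestBefore [simp]: "stable d t0 \<Longrightarrow> stable d t \<Longrightarrow> stable d s \<Longrightarrow>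
    sem e (LongestBefore p t0 t s d) \<longleftrightarrow>
      longest_before (rel p e d) (sem_tm e (t0 d)) (sem_tm e (t d)) (sem_tm e (s d))"
  by (simp add: LongestBefore_def longest_before_def)

lemma sem_MonotoneEnum [simp]: "sem e (MonotoneEnum p d) \<longleftrightarrow> monotone_enum (rel p e d)"
  by (simp add: MonotoneEnum_def monotone_enum_def IsFinite_def is_finite_def)

lemma sem_StageByStage [simp]: "stable d c \<Longrightarrow> stable d t \<Longrightarrow>
    sem e (StageByStage p c t d) \<longleftrightarrow> stage_by_stage (rel p e d) (sem_tm e (c d)) (sem_tm e (t d))"
  by (simp add: StageByStage_def stage_by_stage_def)

lemma sem_BoundedBy [simp]: "stable d b \<Longrightarrow>
    sem e (BoundedBy p b d) \<longleftrightarrow> bounded_by (rel p e d) (sem_tm e (b d))"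
  by (simp add: BoundedBy_def bounded_by_def)

lemma sem_PFUN [simp]: "sem e (PFUN p d) \<longleftrightarrow> (\<forall>x y y'. rel p e d x y \<and> rel p e d x y' \<longrightarrow> y = y')"
  by (simp add: PFUN_def sem_app2)

lemma sem_Approx [simp]: "stable d s \<Longrightarrow>
    sem e (Approx p s d) \<longleftrightarrow> approx (rel p e d) (sem_tm e (s d))"
  by (simp add: Approx_def approx_def sem_app2)

lemma sem_IterationP: "(\<forall>e :: nat \<Rightarrow> 'a. sem e (IterationP p)) \<longleftrightarrow>
    (\<forall>e. (\<forall>x y y'. rel p e 0 x y \<and> rel p e 0 x y' \<longrightarrow> y = y') \<longrightarrow>
      (\<forall>z. \<exists>s. approx (rel p e 0) s \<and> lth s z))"
  by (simp add: IterationP_def sem_sentence)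

lemma sem_BME: "(\<forall>e :: nat \<Rightarrow> 'a. sem e (BME p)) \<longleftrightarrow>
    (\<forall>e. monotone_enum (rel p e 0) \<longrightarrow>
      (\<forall>b. bounded_by (rel p e 0) b \<longrightarrow> is_finite (in_tree (rel p e 0))))"
  by (simp add: BME_def sem_sentence IsFinite_def is_finite_def)

text \<open>The iteration scheme speaks of formulas, whereas \<open>expansion\<close> is a predicate
  whose parameters include those of \<open>E\<close>. \<open>definable_formula\<close> represents it
  by a Sigma_1 formula at a suitable assignment, and iteration is used there.\<close>

lemma BME_valid:
  assumes P: "\<And>p (e :: nat \<Rightarrow> 'a). Sigma1 p \<Longrightarrow> sem e (IterationP p)" and E: "Delta0 E"
  shows "sem (e :: nat \<Rightarrow> 'a) (BME E)"
proof -
  have "is_finite (in_tree (rel E e 0))"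
    if R: "monotone_enum (rel E e 0)" and b: "bounded_by (rel E e 0) b" for e b
  proof -
    \<comment> \<open>Variables 0 and 1 remain arguments; the parameters of \<open>E\<close> are
      frozen at their values in \<open>e\<close>.\<close>
    have "ev e' ((Inl 0 ## Inl (Suc 0) ## (\<lambda>k. Inr (e k))) k) = (e' 0 ## e' (Suc 0) ## e) k"
      for e' k by (auto split: nat.split)
    then have "delta (\<lambda>e'. rel E e 0 (e' 0) (e' (Suc 0)))"
      using E unfolding definable_def
      by (intro exI[of _ E] exI[of _ "Inl 0 ## Inl (Suc 0) ## (\<lambda>k. Inr (e k))"]) simp
    then interpret isigma1_monotone_enum ty "rel E e 0"
      using R by unfold_locales
    obtain p and e' :: "nat \<Rightarrow> 'a" where p: "Sigma1 p"
      "\<And>x. expansion (if 0 < Suc (Suc 0) then x 0 else 0) (if Suc 0 < Suc (Suc 0) then x (Suc 0) else 0) \<longleftrightarrow>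
        sem (\<lambda>k. if k < Suc (Suc 0) then x k else e' (k - Suc (Suc 0))) p"
      using definable_formula[OF sigma_expansion Sigma1_subst, of "Suc (Suc 0)"] by blast
    have "(\<lambda>k. if k < Suc (Suc 0) then (x ## y ## z) k else e' (k - Suc (Suc 0))) = x ## y ## e'"
      for x y and z :: "nat \<Rightarrow> 'a"
      by (rule ext) (auto split: nat.split)
    then have expansion: "expansion = rel p e' 0"
      using p(2)[of "_ ## _ ## _"] by (intro ext) simp
    have "\<forall>x y y'. rel p e' 0 x y \<and> rel p e' 0 x y' \<longrightarrow> y = y'"
      using expansion_unique unfolding expansion by blast
    then have "\<exists>s. approx (rel p e' 0) s \<and> lth s b"
      using P[OF p(1)] sem_IterationP[of p] by blast
    then obtain s where "approx expansion s" "lth s b" unfolding expansion by blast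
    then show ?thesis using b by (rule in_tree_finite)
  qed
  then show ?thesis using sem_BME by blast
qed

end

theorem theorem2p1: "\<forall>p \<in> BME_star. PSigma1 \<turnstile> p"
proof (rule ccontr)
  assume "\<not> ?thesis"
  then have *: "\<exists>p \<in> BME_star. \<not> PSigma1 \<turnstile> p" by blast
  \<comment> \<open>Under the assumption, the globally fixed model satisfies the theory together
    with the negation of one chosen instance.\<close>
  then have th: "model_theory = insert (Neg unprovable) PSigma1" by (simp add: model_theory_def)
  have "sem (e :: nat \<Rightarrow> model) (Induction p)" if "Sigma1 p" for e p
    using that by (intro model_valid) (auto simp: th PSigma1_def ISigma1_def)
  then have ind: "sem (x ## e) p" if "Sigma1 p" "sem (0 ## e) p"
    "\<And>y :: model. sem (y ## e) p \<Longrightarrow> sem ((y + 1) ## e) p" for e x p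
    using that sem_Induction[of p, where 'a = model] by blast
  interpret isigma1 "TYPE(model)"
  proof
    show "0 \<le> x" "0 < x \<Longrightarrow> 1 \<le> x" for x :: model
      using Pminus_model(16,17)[of x] by auto
  qed (rule ind)
  obtain E where E: "unprovable = BME E" "Delta0 E"
    using unprovable(1)[OF *] by (auto simp: BME_star_def)
  have "sem e (IterationP p)" if "Sigma1 p" for e :: "nat \<Rightarrow> model" and p
    using that by (intro model_valid) (auto simp: th PSigma1_def)
  then have "sem (\<lambda>_. 0 :: model) unprovable"
    unfolding E(1) using E(2) by (rule BME_valid)
  moreover have "sem (\<lambda>_. 0 :: model) (Neg unprovable)" by (intro model_valid) (simp add: th)
  ultimately show False by simp
qed

end
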